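(* Let $C\subset\mathbb{R}_+^N$ be a compact convex set containing the standard simplex $\Sigma$ and satisfying condition (†) stated in the context. Let $K\subset\mathbb{C}^N$ be compact, let $\{\zeta_j\}_{j=1}^\infty$ be a sequence of (unweighted) $C$-Leja points for $K$, and let $\Lambda_s:=|VDM(\zeta_1,\dots,\zeta_s)|$ for $s\in\mathbb{N}$. Then $$\lim_{k\to\infty}(\Lambda_{M_k})^{1/L_k}=\delta_C(K).$$
   Context: $\mathbb{R}_+=[0,\infty)$, $\mathbb{N}=\{1,2,\dots\}$, $\mathbb{Z}_+=\{0,1,2,\dots\}$, and $\Sigma=\{x\in\mathbb{R}^N: x_1,\dots,x_N\ge 0,\ x_1+\cdots+x_N\le 1\}$. For $k\in\mathbb{N}$, $M_k$ is the number of points of $kC\cap\mathbb{Z}^N$, and $L_k=\sum_{\alpha\in kC\cap\mathbb{Z}^N}|\alpha|$ with $|\alpha|=\alpha_1+\cdots+\alpha_N$. Orderings: $\alpha\prec\beta$ means that either $|\alpha|<|\beta|$, or $|\alpha|=|\beta|$ and there is $m\in\{1,\dots,N\}$ with $\alpha_m<\beta_m$ and $\alpha_j=\beta_j$ for all $j<m$. For $\alpha\in\mathbb{Z}_+^N$ let $r(\alpha)=\inf\{r\in\mathbb{R}_+:\alpha\in rC\}$. Then $\alpha\prec_C\beta$ means that either $r(\alpha)<r(\beta)$, or $r(\alpha)=r(\beta)$ and $\alpha\prec\beta$. Let $\alpha(1),\alpha(2),\dots$ be the enumeration of $\mathbb{Z}_+^N$ in increasing order with respect to $\prec_C$ (so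 that $\{\alpha(1),\dots,\alpha(M_k)\}=kC\cap\mathbb{Z}^N$ for each $k$). For $\alpha\in kC\cap\mathbb{Z}^N$, $\mathcal{M}_k^{C}(\alpha)$ is the set of polynomials of the form $z^\alpha+\sum_{\beta\in kC\cap\mathbb{Z}^N,\ \beta\prec_C\alpha}a_\beta z^\beta$ with $a_\beta\in\mathbb{C}$. Condition (†) on $C$: given positive integers $k,l$, $\alpha\in kC\cap\mathbb{Z}^N$ and $p\in\mathcal{M}_k^C(\alpha)$, there exists a positive integer $j_0$ such that for any $\delta\in lC\cap\mathbb{Z}^N$ one has $z^\delta p^j\in\mathcal{M}^C_{jk+l}(j\alpha+\delta)$ for all $j\ge j_0$. For points $\zeta_1,\dots,\zeta_s\in\mathbb{C}^N$ let $VDM(\zeta_1,\dots,\zeta_s)=\det[\zeta_l^{\alpha(j)}]_{j,l=1}^s$. A sequence of (unweighted) $C$-Leja points for $K$ is a sequence $\{\zeta_j\}_{j=1}^\infty\subset K$ with $\zeta_1\in K$ arbitrary and, for each $s\ge1$, $$|VDM(\zeta_1,\dots,\zeta_s,\zeta_{s+1})|=\sup_{\eta\in K}|VDM(\zeta_1,\dots,\zeta_s,\eta)|.$$ The (unweighted) $C$-transfinite diameter is $\delta_C(K)=\limsup_{k\to\infty}V_k(K)^{1/L_k}$, where $V_k(K)=\sup\{|VDM(\eta_1,\dots,\eta_{M_k})|:\eta_1,\dots,\eta_{M_k}\in K\}$. *)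

theory Defs
  imports "HOL-Analysis.Analysis" "Jordan_Normal_Form.Determinant"
begin

text \<open>
  Coordinates are indexed by a finite linearly ordered type \<^typ>\<open>'n\<close> with \<open>N = CARD('n) \<ge> 1\<close>; its order
  plays the role of the order \<open>1 < \<dots> < N\<close> in the lexicographic tie-break. A multi-index in
  \<open>\<int>\<^sub>+\<^sup>N\<close> is an element of \<^typ>\<open>nat ^ 'n\<close>. All sequences are indexed from 0: \<open>\<zeta> j\<close> is the point written
  \<open>\<zeta>\<^sub>j\<^sub>+\<^sub>1\<close> in the usual 1-based convention, and likewise for the enumeration of multi-indices.
\<close>

definition std_simplex_Rn :: "(real ^ 'n) set" where
  "std_simplex_Rn = {x. (\<forall>i. 0 \<le> vec_nth x i) \<and> (\<Sum>i\<in>UNIV. vec_nth x i) \<le> 1}"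

definition nonneg_orthant :: "(real ^ 'n) set" where
  "nonneg_orthant = {x. \<forall>i. 0 \<le> vec_nth x i}"

definition real_vec :: "nat ^ 'n \<Rightarrow> real ^ 'n" where
  "real_vec \<alpha> = (\<chi> i. real (vec_nth \<alpha> i))"

definition mdeg :: "nat ^ 'n \<Rightarrow> nat" where
  "mdeg \<alpha> = (\<Sum>i\<in>UNIV. vec_nth \<alpha> i)"

definition mpow :: "complex ^ 'n \<Rightarrow> nat ^ 'n \<Rightarrow> complex" where
  "mpow z \<alpha> = (\<Prod>i\<in>UNIV. vec_nth z i ^ vec_nth \<alpha> i)"

text \<open>\<open>kC \<inter> \<int>\<^sup>N\<close>. Since \<open>C\<close> will lie in the nonnegative orthant, only multi-indices with natural number
  entries occur.\<close>

definition lattice_pts :: "(real ^ 'n) set \<Rightarrow> nat \<Rightarrow> (nat ^ 'n) set" where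
  "lattice_pts C k = {\<alpha>. real_vec \<alpha> \<in> (\<lambda>x. real k *\<^sub>R x) ` C}"

definition M_num :: "(real ^ 'n) set \<Rightarrow> nat \<Rightarrow> nat" where
  "M_num C k = card (lattice_pts C k)"

definition L_num :: "(real ^ 'n) set \<Rightarrow> nat \<Rightarrow> nat" where
  "L_num C k = (\<Sum>\<alpha>\<in>lattice_pts C k. mdeg \<alpha>)"

definition grlex_less ::
    "nat ^ 'n::{finite,linorder} \<Rightarrow> nat ^ 'n::{finite,linorder} \<Rightarrow> bool" where
  "grlex_less \<alpha> \<beta> \<longleftrightarrow> mdeg \<alpha> < mdeg \<beta> \<or>
     (mdeg \<alpha> = mdeg \<beta> \<and>
       (\<exists>m. vec_nth \<alpha> m < vec_nth \<beta> m \<and> (\<forall>j<m. vec_nth \<alpha> j = vec_nth \<beta> j)))"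

definition C_rad :: "(real ^ 'n) set \<Rightarrow> nat ^ 'n \<Rightarrow> real" where
  "C_rad C \<alpha> = Inf {r. 0 \<le> r \<and> real_vec \<alpha> \<in> (\<lambda>x. r *\<^sub>R x) ` C}"

definition C_less ::
    "(real ^ 'n::{finite,linorder}) set \<Rightarrow>
      nat ^ 'n::{finite,linorder} \<Rightarrow> nat ^ 'n::{finite,linorder} \<Rightarrow> bool" where
  "C_less C \<alpha> \<beta> \<longleftrightarrow> C_rad C \<alpha> < C_rad C \<beta> \<or> (C_rad C \<alpha> = C_rad C \<beta> \<and> grlex_less \<alpha> \<beta>)"

definition C_increasing_enumeration ::
    "(real ^ 'n::{finite,linorder}) set \<Rightarrow> (nat \<Rightarrow> nat ^ 'n::{finite,linorder}) \<Rightarrow> bool" where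
  "C_increasing_enumeration C a \<longleftrightarrow> (\<forall>i j. i < j \<longrightarrow> C_less C (a i) (a j)) \<and> range a = UNIV"

text \<open>Well defined for the bodies \<open>C\<close> under consideration, see \<open>C_enum_increasing_enumeration\<close> below.\<close>

definition C_enum ::
    "(real ^ 'n::{finite,linorder}) set \<Rightarrow> nat \<Rightarrow> nat ^ 'n::{finite,linorder}" where
  "C_enum C = (THE a. C_increasing_enumeration C a)"

text \<open>\<open>\<M>\<^sub>k\<^sup>C(\<alpha>)\<close>, with polynomials regarded as functions on \<open>\<complex>\<^sup>N\<close>.\<close>

definition C_monic ::
    "(real ^ 'n::{finite,linorder}) set \<Rightarrow> nat \<Rightarrow> nat ^ 'n::{finite,linorder} \<Rightarrow>
      (complex ^ 'n::{finite,linorder} \<Rightarrow> complex) set" where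
  "C_monic C k \<alpha> =
     {p. \<exists>a :: nat ^ 'n::{finite,linorder} \<Rightarrow> complex.
          p = (\<lambda>z. mpow z \<alpha> + (\<Sum>\<beta>\<in>{\<beta> \<in> lattice_pts C k. C_less C \<beta> \<alpha>}. a \<beta> * mpow z \<beta>))}"

definition dagger_condition :: "(real ^ 'n::{finite,linorder}) set \<Rightarrow> bool" where
  "dagger_condition C \<longleftrightarrow>
     (\<forall>k>0. \<forall>l>0. \<forall>\<alpha>\<in>lattice_pts C k. \<forall>p\<in>C_monic C k \<alpha>.
        \<exists>j0>0. \<forall>\<delta>\<in>lattice_pts C l. \<forall>j\<ge>j0.
          (\<lambda>z. mpow z \<delta> * p z ^ j) \<in> C_monic C (j * k + l) (j *s \<alpha> + \<delta>))"

text \<open>\<open>VDM(\<eta>\<^sub>1, \<dots>, \<eta>\<^sub>s)\<close>; only the values \<open>\<eta> 0, \<dots>, \<eta> (s - 1)\<close> enter.\<close>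

definition VDM ::
    "(real ^ 'n::{finite,linorder}) set \<Rightarrow> nat \<Rightarrow> (nat \<Rightarrow> complex ^ 'n::{finite,linorder}) \<Rightarrow> complex" where
  "VDM C s \<eta> = Determinant.det (Matrix.mat s s (\<lambda>(j, l). mpow (\<eta> l) (C_enum C j)))"

definition C_Leja ::
    "(real ^ 'n::{finite,linorder}) set \<Rightarrow> (complex ^ 'n::{finite,linorder}) set \<Rightarrow>
      (nat \<Rightarrow> complex ^ 'n::{finite,linorder}) \<Rightarrow> bool" where
  "C_Leja C K \<zeta> \<longleftrightarrow> (\<forall>j. \<zeta> j \<in> K) \<and>
     (\<forall>s\<ge>1. cmod (VDM C (Suc s) \<zeta>) = (SUP \<eta>\<in>K. cmod (VDM C (Suc s) (\<zeta>(s := \<eta>)))))"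

definition V_max ::
    "(real ^ 'n::{finite,linorder}) set \<Rightarrow> (complex ^ 'n::{finite,linorder}) set \<Rightarrow> nat \<Rightarrow> real" where
  "V_max C K k =
     (SUP \<eta>\<in>{\<eta>. \<forall>j<M_num C k. \<eta> j \<in> K}. cmod (VDM C (M_num C k) \<eta>))"

definition transfinite_diameter ::
    "(real ^ 'n::{finite,linorder}) set \<Rightarrow> (complex ^ 'n::{finite,linorder}) set \<Rightarrow> ereal" where
  "transfinite_diameter C K = limsup (\<lambda>k. ereal (V_max C K k powr (1 / real (L_num C k))))"

lemma grlex_less_irrefl: "\<not> grlex_less \<alpha> \<alpha>"
  by (auto simp: grlex_less_def)

lemma grlex_less_trans:
  assumes "grlex_less \<alpha> \<beta>" "grlex_less \<beta> \<gamma>"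
  shows "grlex_less \<alpha> \<gamma>"
proof -
  have "\<exists>m. vec_nth \<alpha> m < vec_nth \<gamma> m \<and> (\<forall>j<m. vec_nth \<alpha> j = vec_nth \<gamma> j)"
    if "vec_nth \<alpha> m < vec_nth \<beta> m" "\<forall>j<m. vec_nth \<alpha> j = vec_nth \<beta> j"
       "vec_nth \<beta> n < vec_nth \<gamma> n" "\<forall>j<n. vec_nth \<beta> j = vec_nth \<gamma> j" for m n
  proof (rule exI[of _ "min m n"])
    show "vec_nth \<alpha> (min m n) < vec_nth \<gamma> (min m n) \<and>
        (\<forall>j<min m n. vec_nth \<alpha> j = vec_nth \<gamma> j)"
      using that by (cases m n rule: linorder_cases) (auto simp: min_def)
  qed
  then show ?thesis
    using assms unfolding grlex_less_def by (elim disjE conjE exE) auto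
qed

lemma grlex_less_total:
  assumes "\<alpha> \<noteq> \<beta>"
  shows "grlex_less \<alpha> \<beta> \<or> grlex_less \<beta> \<alpha>"
proof -
  define m where "m = Min {i. vec_nth \<alpha> i \<noteq> vec_nth \<beta> i}"
  have "{i. vec_nth \<alpha> i \<noteq> vec_nth \<beta> i} \<noteq> {}"
    using assms by (auto simp: Finite_Cartesian_Product.vec_eq_iff)
  then have "m \<in> {i. vec_nth \<alpha> i \<noteq> vec_nth \<beta> i}"
    unfolding m_def by (intro Min_in) auto
  moreover have "vec_nth \<alpha> j = vec_nth \<beta> j" if "j < m" for j
    using that unfolding m_def
    by (metis (mono_tags, lifting) Min_le finite linorder_not_le mem_Collect_eq)
  ultimately have "(\<exists>m. vec_nth \<alpha> m < vec_nth \<beta> m \<and> (\<forall>j<m. vec_nth \<alpha> j = vec_nth \<beta> j)) \<or>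
      (\<exists>m. vec_nth \<beta> m < vec_nth \<alpha> m \<and> (\<forall>j<m. vec_nth \<beta> j = vec_nth \<alpha> j))"
    by (metis (mono_tags) mem_Collect_eq nat_neq_iff)
  then show ?thesis
    unfolding grlex_less_def by (metis nat_neq_iff)
qed

lemma C_less_irrefl: "\<not> C_less C \<alpha> \<alpha>"
  by (simp add: C_less_def grlex_less_irrefl)

lemma C_less_trans: "C_less C \<alpha> \<beta> \<Longrightarrow> C_less C \<beta> \<gamma> \<Longrightarrow> C_less C \<alpha> \<gamma>"
  by (auto simp: C_less_def intro: grlex_less_trans)

lemma C_less_total: "\<alpha> \<noteq> \<beta> \<Longrightarrow> C_less C \<alpha> \<beta> \<or> C_less C \<beta> \<alpha>"
  using grlex_less_total[of \<alpha> \<beta>] by (auto simp: C_less_def)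

lemma finite_C_less:
  fixes C :: "(real ^ 'n::{finite,linorder}) set"
  assumes bdd: "bounded C" and simplex: "std_simplex_Rn \<subseteq> C"
  shows "finite {\<beta>. C_less C \<beta> \<alpha>}"
proof -
  obtain B where B: "\<And>x. x \<in> C \<Longrightarrow> norm x \<le> B"
    using bdd by (auto simp: bounded_iff)
  define R where "R = (C_rad C \<alpha> + 1) * \<bar>B\<bar>"
  have le_R: "real (vec_nth \<beta> i) \<le> R" if "C_less C \<beta> \<alpha>" for \<beta> i
  proof -
    let ?S = "{r. 0 \<le> r \<and> real_vec \<beta> \<in> (\<lambda>x. r *\<^sub>R x) ` C}"
    define d where "d = real (mdeg \<beta>) + 1"
    have d: "d > 0" by (simp add: d_def)
    have "(1 / d) *\<^sub>R real_vec \<beta> \<in> std_simplex_Rn"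
      using d by (simp add: std_simplex_Rn_def real_vec_def d_def mdeg_def
          flip: sum_divide_distrib)
    then have "(1 / d) *\<^sub>R real_vec \<beta> \<in> C" using simplex by blast
    then have "d *\<^sub>R ((1 / d) *\<^sub>R real_vec \<beta>) \<in> (\<lambda>x. d *\<^sub>R x) ` C" by blast
    then have "d \<in> ?S" using d by simp
    then have ne: "?S \<noteq> {}" by blast
    have "Inf ?S < C_rad C \<alpha> + 1"
      using that by (auto simp: C_less_def C_rad_def)
    then obtain r where r: "r \<in> ?S" "r < C_rad C \<alpha> + 1"
      using cInf_lessD[OF ne] by blast
    then obtain x where x: "x \<in> C" "real_vec \<beta> = r *\<^sub>R x" "0 \<le> r" by blast
    have "real (vec_nth \<beta> i) = \<bar>vec_nth (real_vec \<beta>) i\<bar>" by (simp add: real_vec_def)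
    also have "\<dots> \<le> norm (real_vec \<beta>)" by (rule component_le_norm_cart)
    also have "\<dots> = r * norm x" using x by simp
    also have "\<dots> \<le> R"
      unfolding R_def using r x B[OF x(1)] by (intro mult_mono) auto
    finally show ?thesis .
  qed
  have "{\<beta>. C_less C \<beta> \<alpha>} \<subseteq> (\<lambda>f. vec_lambda f) ` {f. \<forall>i. f i \<in> {..nat \<lfloor>R\<rfloor>}}"
  proof
    fix \<beta> assume "\<beta> \<in> {\<beta>. C_less C \<beta> \<alpha>}"
    then have "vec_nth \<beta> i \<le> nat \<lfloor>R\<rfloor>" for i
      using le_R[of \<beta> i] by (simp add: le_nat_floor)
    then show "\<beta> \<in> (\<lambda>f. vec_lambda f) ` {f. \<forall>i. f i \<in> {..nat \<lfloor>R\<rfloor>}}"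
      by (intro image_eqI[of _ _ "vec_nth \<beta>"]) auto
  qed
  moreover have "finite {f :: 'n \<Rightarrow> nat. \<forall>i. f i \<in> {..nat \<lfloor>R\<rfloor>}}"
    using finite_PiE[of "UNIV :: 'n set" "\<lambda>_. {..nat \<lfloor>R\<rfloor>}"]
    by (simp add: PiE_def Pi_def extensional_def)
  ultimately show ?thesis
    by (meson finite_imageI finite_subset)
qed

lemma C_increasing_enumeration_unique:
  assumes "C_increasing_enumeration C a" "C_increasing_enumeration C b"
  shows "a = b"
proof -
  have rank: "card {\<beta>. C_less C \<beta> (c n)} = n" if c: "C_increasing_enumeration C c" for c n
  proof -
    have mono: "C_less C (c i) (c j)" if "i < j" for i j
      using c that by (simp add: C_increasing_enumeration_def)
    have iff: "C_less C (c i) (c j) \<longleftrightarrow> i < j" for i j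
      using mono C_less_irrefl C_less_trans by (metis linorder_neqE_nat)
    have surj: "range c = UNIV"
      using c by (simp add: C_increasing_enumeration_def)
    have "{\<beta>. C_less C \<beta> (c n)} = c ` {..<n}"
    proof
      show "{\<beta>. C_less C \<beta> (c n)} \<subseteq> c ` {..<n}"
      proof
        fix \<beta> assume \<beta>: "\<beta> \<in> {\<beta>. C_less C \<beta> (c n)}"
        obtain i where "\<beta> = c i" using surj by (metis UNIV_I imageE)
        with \<beta> iff show "\<beta> \<in> c ` {..<n}" by auto
      qed
    qed (auto simp: iff)
    moreover have "inj c"
      using mono C_less_irrefl by (metis injI linorder_neqE_nat)
    ultimately show ?thesis
      by (simp add: card_image inj_on_subset)
  qed
  show ?thesis
  proof
    fix n
    obtain m where m: "a n = b m"
      using assms(2) unfolding C_increasing_enumeration_def by (metis UNIV_I imageE)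
    have "n = m" using rank[OF assms(1), of n] rank[OF assms(2), of m] m by simp
    with m show "a n = b n" by simp
  qed
qed

lemma C_increasing_enumeration_exists:
  fixes C :: "(real ^ 'n::{finite,linorder}) set"
  assumes "bounded C" "std_simplex_Rn \<subseteq> C"
  shows "\<exists>a. C_increasing_enumeration C a"
proof -
  define f where "f \<alpha> = card {\<beta>. C_less C \<beta> \<alpha>}" for \<alpha> :: "nat ^ 'n::{finite,linorder}"
  have fin: "finite {\<beta>. C_less C \<beta> \<alpha>}" for \<alpha>
    using assms by (rule finite_C_less)
  have f_mono: "f \<alpha> < f \<beta>" if "C_less C \<alpha> \<beta>" for \<alpha> \<beta>
    unfolding f_def
  proof (intro psubset_card_mono fin psubsetI subsetI)
    show "{\<gamma>. C_less C \<gamma> \<alpha>} \<noteq> {\<gamma>. C_less C \<gamma> \<beta>}"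
      using that C_less_irrefl by blast
  qed (use that in \<open>auto intro: C_less_trans\<close>)
  have f_iff: "C_less C \<alpha> \<beta> \<longleftrightarrow> f \<alpha> < f \<beta>" for \<alpha> \<beta>
    using f_mono C_less_total by (metis order_less_asym order_less_irrefl)
  have inj: "inj f"
    using f_mono C_less_total by (metis injI order_less_irrefl)
  have down: "n \<in> range f" if "n \<le> f \<alpha>" for n \<alpha>
  proof (cases "n = f \<alpha>")
    case False
    have "f ` {\<beta>. C_less C \<beta> \<alpha>} \<subseteq> {..<f \<alpha>}" by (auto simp: f_iff)
    moreover have "card (f ` {\<beta>. C_less C \<beta> \<alpha>}) = card {..<f \<alpha>}"
      using inj by (subst card_image) (auto simp: f_def inj_on_def)
    ultimately have "f ` {\<beta>. C_less C \<beta> \<alpha>} = {..<f \<alpha>}"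
      by (intro card_subset_eq) auto
    moreover have "n \<in> {..<f \<alpha>}" using that False by simp
    ultimately show ?thesis by blast
  qed auto
  have infin: "infinite (UNIV :: (nat ^ 'n::{finite,linorder}) set)"
  proof
    assume "finite (UNIV :: (nat ^ 'n::{finite,linorder}) set)"
    then have "finite (range (\<lambda>k. (\<chi> i. k) :: nat ^ 'n::{finite,linorder}))"
      using finite_subset[OF subset_UNIV] by blast
    moreover have "inj (\<lambda>k. (\<chi> i. k) :: nat ^ 'n::{finite,linorder})"
      by (auto intro!: injI simp: Finite_Cartesian_Product.vec_eq_iff)
    ultimately show False using finite_imageD by blast
  qed
  have "surj f"
  proof -
    have "n \<in> range f" for n
    proof (rule ccontr)
      assume "n \<notin> range f"
      then have "range f \<subseteq> {..<n}"
        using down by (metis image_subsetI lessThan_iff not_le_imp_less)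
      then have "finite (range f)" by (rule finite_subset) simp
      with inj infin show False using finite_imageD by blast
    qed
    then show ?thesis by blast
  qed
  with inj have "bij f" by (simp add: bij_def)
  have "C_increasing_enumeration C (inv_into UNIV f)"
    unfolding C_increasing_enumeration_def
    using \<open>bij f\<close> \<open>surj f\<close> by (auto simp: f_iff surj_f_inv_f bij_imp_bij_inv bij_is_surj)
  then show ?thesis by blast
qed

lemma C_enum_increasing_enumeration:
  fixes C :: "(real ^ 'n::{finite,linorder}) set"
  assumes "bounded C" "std_simplex_Rn \<subseteq> C"
  shows "C_increasing_enumeration C (C_enum C)"
  unfolding C_enum_def
  using C_increasing_enumeration_exists[OF assms] C_increasing_enumeration_unique
  by (metis theI)

end

theory Submission
  imports Defs "HOL-Real_Asymp.Real_Asymp"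
begin

text \<open>
  For a basis of monomials listed in some order, let \<open>T\<^sub>j\<close> be the least sup norm on \<open>K\<close> of a polynomial
  with leading term the \<open>j\<close>-th monomial. Replacing rows of the Vandermonde matrix by such
  polynomials gives \<open>\<Prod> T\<^sub>j \<le> \<Lambda>\<^sub>s \<le> V\<^sub>s \<le> s! \<Prod> T\<^sub>j\<close>, where \<open>V\<^sub>s\<close> is the maximal Vandermonde
  determinant of \<open>s\<close> points of \<open>K\<close>. Since \<open>(M\<^sub>k!)\<close> to the power \<open>1 / L\<^sub>k\<close> tends to 1, only the
  existence of the limit defining \<open>\<delta>\<^sub>C(K)\<close> remains.

  Up to sign, the determinant does not depend on the order of the monomials in \<open>kC\<close>, so for this last
  step the order \<open>\<prec>\<^sub>C\<close> is replaced by the graded lexicographic order. The latter is compatible with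
  addition, which makes the constants submultiplicative: \<open>T\<^sub>k\<^sub>+\<^sub>l(\<alpha> + \<beta>) \<le> T\<^sub>k(\<alpha>) T\<^sub>l(\<beta>)\<close>. Hence
  \<open>\<psi>\<^sub>k(\<alpha>) = |\<alpha>| log R - log T\<^sub>k(\<alpha>)\<close>, for \<open>R\<close> bounding the coordinates on \<open>K\<close>, is nonnegative and
  superadditive. A Fekete argument in which each \<open>\<alpha> \<in> mC\<close> controls the box \<open>j\<alpha> + [0, j)\<^sup>N\<close> inside
  \<open>nC\<close>, for \<open>j(m + N) \<le> n\<close>, shows that \<open>\<Sum> \<psi>\<^sub>n\<close> divided by the \<open>(N + 1)\<close>-st power of \<open>n + N\<close>
  converges. Taking \<open>\<psi>\<^sub>k(\<alpha>) = |\<alpha>|\<close> gives the same for \<open>L\<^sub>n\<close>.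
\<close>

section \<open>Generalized Vandermonde determinants and Chebyshev constants\<close>

definition gen_vdm :: "('i \<Rightarrow> 'x \<Rightarrow> complex) \<Rightarrow> (nat \<Rightarrow> 'i) \<Rightarrow> nat \<Rightarrow> (nat \<Rightarrow> 'x) \<Rightarrow> complex" where
  "gen_vdm e g s \<eta> = Determinant.det (Matrix.mat s s (\<lambda>(j, l). e (g j) (\<eta> l)))"

text \<open>Collecting all bounds instead of the sup norm itself avoids requiring a supremum over
  \<open>K\<close> to exist. The set \<open>B\<close> holds the indices of the lower terms.\<close>

definition monic_bounds :: "('i \<Rightarrow> 'x \<Rightarrow> complex) \<Rightarrow> 'x set \<Rightarrow> 'i set \<Rightarrow> 'i \<Rightarrow> real set" where
  "monic_bounds e K B i =
     {c. 0 \<le> c \<and> (\<exists>a. a i = 1 \<and> (\<forall>z\<in>K. cmod (\<Sum>b\<in>insert i B. a b * e b z) \<le> c))}"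

text \<open>The infimum is unspecified if there is no bound at all, hence the nonemptiness
  hypotheses that follow.\<close>

definition chebyshev_const :: "('i \<Rightarrow> 'x \<Rightarrow> complex) \<Rightarrow> 'x set \<Rightarrow> 'i set \<Rightarrow> 'i \<Rightarrow> real" where
  "chebyshev_const e K B i = Inf (monic_bounds e K B i)"

lemma monic_bounds_nonneg: "c \<in> monic_bounds e K B i \<Longrightarrow> 0 \<le> c"
  by (simp add: monic_bounds_def)

lemma chebyshev_const_le: "c \<in> monic_bounds e K B i \<Longrightarrow> chebyshev_const e K B i \<le> c"
  unfolding chebyshev_const_def
  by (intro cInf_lower bdd_belowI[of _ 0]) (auto simp: monic_bounds_nonneg)

lemma bound_in_monic_bounds:
  assumes "finite B" "\<And>z. z \<in> K \<Longrightarrow> cmod (e i z) \<le> c" "0 \<le> c"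
  shows "c \<in> monic_bounds e K B i"
proof -
  have "(\<Sum>b\<in>insert i B. (if b = i then 1 else 0) * e b z) = e i z" for z
    using assms(1) by (subst sum.remove[of _ i]) (auto intro!: sum.neutral)
  then show ?thesis
    unfolding monic_bounds_def using assms by (auto intro!: exI[of _ "\<lambda>b. if b = i then 1 else 0"])
qed

lemma chebyshev_const_nonneg:
  assumes "monic_bounds e K B i \<noteq> {}"
  shows "0 \<le> chebyshev_const e K B i"
  unfolding chebyshev_const_def using assms by (intro cInf_greatest) (auto simp: monic_bounds_nonneg)

text \<open>Lets an estimate valid for every admissible bound pass to the infimum, so that no
  extremal polynomial has to be produced.\<close>

lemma le_mult_chebyshev_const:
  assumes "monic_bounds e K B i \<noteq> {}" "0 \<le> y"
    and le: "\<And>c. c \<in> monic_bounds e K B i \<Longrightarrow> x \<le> y * c"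
  shows "x \<le> y * chebyshev_const e K B i"
proof (cases "y = 0")
  case True
  then show ?thesis using assms by auto
next
  case False
  with assms(2) have y: "y > 0" by simp
  have "x / y \<le> chebyshev_const e K B i"
    unfolding chebyshev_const_def using assms(1) le y
    by (intro cInf_greatest) (auto simp: field_simps)
  then show ?thesis using y by (simp add: field_simps)
qed

lemma gen_vdm_0 [simp]: "gen_vdm e g 0 \<eta> = 1"
  by (simp add: gen_vdm_def)

text \<open>Adding multiples of the earlier rows to the last row turns it into the values of a monic
  polynomial without changing the determinant. The sum is the expansion along that row;
  \<open>insert_index l\<close> skips the point \<open>\<eta> l\<close>.\<close>

lemma gen_vdm_Suc:
  assumes inj: "inj_on g {..s}" and a: "a (g s) = 1"
  shows "gen_vdm e g (Suc s) \<eta> =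
    (\<Sum>l<Suc s. (\<Sum>b\<in>insert (g s) (g ` {..<s}). a b * e b (\<eta> l)) *
       ((-1) ^ (s + l) * gen_vdm e g s (\<eta> \<circ> insert_index l)))"
proof -
  define A where "A = Matrix.mat (Suc s) (Suc s) (\<lambda>(j, l). e (g j) (\<eta> l))"
  have A: "A \<in> carrier_mat (Suc s) (Suc s)" by (simp add: A_def)
  \<comment> \<open>Pairing row \<open>j\<close> with the cofactors of row \<open>s\<close> gives
    the entry \<open>(j, s)\<close> of \<open>A * adj_mat A\<close>, a multiple of the
    identity.\<close>
  have row: "(\<Sum>l<Suc s. e (g j) (\<eta> l) * cofactor A s l) =
      (if j = s then Determinant.det A else 0)" if "j \<le> s" for j
  proof -
    have "(A * adj_mat A) $$ (j, s) = (Determinant.det A \<cdot>\<^sub>m 1\<^sub>m (Suc s)) $$ (j, s)"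
      using adj_mat(2)[OF A] by simp
    moreover have "(A * adj_mat A) $$ (j, s) = (\<Sum>l<Suc s. e (g j) (\<eta> l) * cofactor A s l)"
      using that by (simp add: A_def adj_mat_def scalar_prod_def lessThan_atLeast0)
    ultimately show ?thesis using that by simp
  qed
  have cof: "cofactor A s l = (-1) ^ (s + l) * gen_vdm e g s (\<eta> \<circ> insert_index l)" if "l < Suc s" for l
  proof -
    have "mat_delete A s l = Matrix.mat s s (\<lambda>(j, l'). e (g j) ((\<eta> \<circ> insert_index l) l'))"
      using that by (intro eq_matI) (auto simp: mat_delete_def A_def insert_index_def)
    then show ?thesis by (simp add: cofactor_def gen_vdm_def)
  qed
  have ins: "insert (g s) (g ` {..<s}) = g ` {..s}"
    by (auto simp: ivl_disj_un(2)[symmetric])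
  have "(\<Sum>l<Suc s. (\<Sum>b\<in>insert (g s) (g ` {..<s}). a b * e b (\<eta> l)) * cofactor A s l) =
      (\<Sum>l<Suc s. \<Sum>j\<le>s. a (g j) * (e (g j) (\<eta> l) * cofactor A s l))"
    unfolding ins by (simp add: sum.reindex[OF inj] sum_distrib_right mult.assoc del: sum.lessThan_Suc)
  also have "\<dots> = (\<Sum>j\<le>s. a (g j) * (\<Sum>l<Suc s. e (g j) (\<eta> l) * cofactor A s l))"
    by (subst sum.swap) (simp add: sum_distrib_left del: sum.lessThan_Suc)
  also have "\<dots> = (\<Sum>j\<le>s. if j = s then Determinant.det A else 0)"
    by (intro sum.cong refl) (simp add: row a del: sum.lessThan_Suc)
  also have "\<dots> = gen_vdm e g (Suc s) \<eta>"
    by (simp add: gen_vdm_def A_def)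
  finally show ?thesis
    by (simp add: cof del: sum.lessThan_Suc)
qed

lemma cmod_gen_vdm_Suc_le:
  assumes inj: "inj_on g {..s}" and c: "c \<in> monic_bounds e K (g ` {..<s}) (g s)"
    and U: "\<And>\<eta>. (\<And>j. j < s \<Longrightarrow> \<eta> j \<in> K) \<Longrightarrow> cmod (gen_vdm e g s \<eta>) \<le> U"
    and \<eta>: "\<And>j. j < Suc s \<Longrightarrow> \<eta> j \<in> K"
  shows "cmod (gen_vdm e g (Suc s) \<eta>) \<le> real (Suc s) * U * c"
proof -
  obtain a where a: "a (g s) = 1"
    and ac: "\<And>z. z \<in> K \<Longrightarrow> cmod (\<Sum>b\<in>insert (g s) (g ` {..<s}). a b * e b z) \<le> c"
    using c by (auto simp: monic_bounds_def)
  have "cmod ((\<Sum>b\<in>insert (g s) (g ` {..<s}). a b * e b (\<eta> l)) *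
       ((-1) ^ (s + l) * gen_vdm e g s (\<eta> \<circ> insert_index l))) \<le> c * U" if "l < Suc s" for l
  proof -
    have "cmod (gen_vdm e g s (\<eta> \<circ> insert_index l)) \<le> U"
      using that by (intro U) (auto simp: insert_index_def intro!: \<eta>)
    then show ?thesis
      unfolding norm_mult norm_power using ac[OF \<eta>[OF that]] monic_bounds_nonneg[OF c]
      by (intro mult_mono) auto
  qed
  then have "cmod (gen_vdm e g (Suc s) \<eta>) \<le> (\<Sum>l<Suc s. c * U)"
    unfolding gen_vdm_Suc[where a = a, OF inj a] by (intro sum_norm_le) auto
  also have "\<dots> = real (Suc s) * U * c" by simp
  finally show ?thesis .
qed

text \<open>As a function of its last point, the determinant of \<open>Suc s\<close> points is
  \<open>gen_vdm e g s \<eta>\<close> times a polynomial with leading coefficient 1, whose norm is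
  at least the Chebyshev constant.\<close>

lemma cmod_gen_vdm_mult_chebyshev_const_le:
  assumes inj: "inj_on g {..s}"
    and U: "\<And>x. x \<in> K \<Longrightarrow> cmod (gen_vdm e g (Suc s) (\<eta>(s := x))) \<le> U" and "0 \<le> U"
  shows "cmod (gen_vdm e g s \<eta>) * chebyshev_const e K (g ` {..<s}) (g s) \<le> U"
proof (cases "gen_vdm e g s \<eta> = 0")
  case True
  then show ?thesis using \<open>0 \<le> U\<close> by simp
next
  case False
  define d where "d = gen_vdm e g s \<eta>"
  define A where "A x = Matrix.mat (Suc s) (Suc s) (\<lambda>(j, l). e (g j) ((\<eta>(s := x)) l))" for x
  \<comment> \<open>Cofactors of the last column do not involve the last point, so any value may
    stand in for it. Divided by the leading one, \<open>d\<close>, they are the coefficients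
    \<open>a\<close> of the monic polynomial.\<close>
  define cf where "cf j = cofactor (A undefined) j s" for j
  define a where "a b = cf (the_inv_into {..s} g b) / d" for b
  have cf: "cofactor (A x) j s = cf j" if "j \<le> s" for x j
  proof -
    have "mat_delete (A x) j s = mat_delete (A undefined) j s"
      using that by (intro eq_matI) (auto simp: mat_delete_def A_def)
    then show ?thesis by (simp add: cofactor_def cf_def)
  qed
  have cfs: "cf s = d"
  proof -
    have "mat_delete (A undefined) s s = Matrix.mat s s (\<lambda>(j, l). e (g j) (\<eta> l))"
      by (intro eq_matI) (auto simp: mat_delete_def A_def)
    then show ?thesis by (simp add: cf_def d_def cofactor_def gen_vdm_def)
  qed
  have ag: "a (g j) = cf j / d" if "j \<le> s" for j
    using that inj by (simp add: a_def the_inv_into_f_f)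
  have ins: "insert (g s) (g ` {..<s}) = g ` {..s}"
    by (auto simp: ivl_disj_un(2)[symmetric])
  have expand: "gen_vdm e g (Suc s) (\<eta>(s := x)) =
      d * (\<Sum>b\<in>insert (g s) (g ` {..<s}). a b * e b x)" for x
  proof -
    have "gen_vdm e g (Suc s) (\<eta>(s := x)) = Determinant.det (A x)"
      by (simp add: gen_vdm_def A_def)
    also have "\<dots> = (\<Sum>j<Suc s. A x $$ (j, s) * cofactor (A x) j s)"
      by (rule laplace_expansion_column) (simp_all add: A_def)
    also have "\<dots> = (\<Sum>j\<le>s. d * (a (g j) * e (g j) x))"
      unfolding lessThan_Suc_atMost
      using False by (intro sum.cong refl) (simp add: cf ag d_def, simp add: A_def)
    also have "\<dots> = d * (\<Sum>b\<in>g ` {..s}. a b * e b x)"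
      by (simp add: sum.reindex[OF inj] sum_distrib_left)
    finally show ?thesis by (simp add: ins)
  qed
  have d: "d \<noteq> 0" using False by (simp add: d_def)
  have "U / cmod d \<in> monic_bounds e K (g ` {..<s}) (g s)"
    unfolding monic_bounds_def
  proof (intro CollectI conjI exI[of _ a] ballI)
    show "a (g s) = 1" using ag[of s] cfs d by simp
    show "cmod (\<Sum>b\<in>insert (g s) (g ` {..<s}). a b * e b z) \<le> U / cmod d" if "z \<in> K" for z
      using U[OF that] d unfolding expand by (simp add: norm_mult field_simps)
  qed (use \<open>0 \<le> U\<close> in simp)
  from chebyshev_const_le[OF this] show ?thesis
    using d by (simp add: d_def field_simps)
qed

text \<open>Each added point contributes the number of terms in the row expansion times one
  Chebyshev constant; the numbers of terms multiply to the factorial.\<close>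

lemma cmod_gen_vdm_le:
  assumes inj: "inj_on g {..<s}"
    and ne: "\<And>j. j < s \<Longrightarrow> monic_bounds e K (g ` {..<j}) (g j) \<noteq> {}"
    and \<eta>: "\<And>j. j < s \<Longrightarrow> \<eta> j \<in> K"
  shows "cmod (gen_vdm e g s \<eta>) \<le> fact s * (\<Prod>j<s. chebyshev_const e K (g ` {..<j}) (g j))"
  using assms
proof (induction s arbitrary: \<eta>)
  case (Suc s)
  let ?T = "\<lambda>j. chebyshev_const e K (g ` {..<j}) (g j)"
  let ?U = "fact s * (\<Prod>j<s. ?T j)"
  have U: "cmod (gen_vdm e g s \<eta>) \<le> ?U" if "\<And>j. j < s \<Longrightarrow> \<eta> j \<in> K" for \<eta>
    using Suc.prems that by (intro Suc.IH) (auto elim: inj_on_subset)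
  have inj: "inj_on g {..s}" using Suc.prems(1) by (simp add: lessThan_Suc_atMost)
  have "0 \<le> ?U"
    using Suc.prems(2) by (intro mult_nonneg_nonneg prod_nonneg ballI chebyshev_const_nonneg) auto
  then have "cmod (gen_vdm e g (Suc s) \<eta>) \<le> (real (Suc s) * ?U) * ?T s"
    using Suc.prems cmod_gen_vdm_Suc_le[OF inj _ U]
    by (intro le_mult_chebyshev_const) auto
  then show ?case by (simp add: algebra_simps)
qed simp

text \<open>The induction is over all upper bounds \<open>U\<close>, so no maximizing points are
  chosen: \<open>U\<close> divided by the last Chebyshev constant bounds the determinants with one
  point fewer.\<close>

lemma prod_chebyshev_const_le:
  assumes inj: "inj_on g {..<s}" and "K \<noteq> {}"
    and ne: "\<And>j. j < s \<Longrightarrow> monic_bounds e K (g ` {..<j}) (g j) \<noteq> {}"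
    and U: "\<And>\<eta>. (\<And>j. j < s \<Longrightarrow> \<eta> j \<in> K) \<Longrightarrow> cmod (gen_vdm e g s \<eta>) \<le> U"
  shows "(\<Prod>j<s. chebyshev_const e K (g ` {..<j}) (g j)) \<le> U"
  using assms
proof (induction s arbitrary: U)
  case 0
  then show ?case using "0.prems"(4)[of undefined] by simp
next
  case (Suc s)
  let ?T = "\<lambda>j. chebyshev_const e K (g ` {..<j}) (g j)"
  have inj: "inj_on g {..s}" using Suc.prems(1) by (simp add: lessThan_Suc_atMost)
  have inj': "inj_on g {..<s}" using inj by (rule inj_on_subset) auto
  have T: "0 \<le> ?T s" using Suc.prems(3) by (intro chebyshev_const_nonneg) auto
  obtain x where "x \<in> K" using \<open>K \<noteq> {}\<close> by blast
  then have U0: "0 \<le> U"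
    using Suc.prems(4)[of "\<lambda>_. x"] norm_ge_zero order_trans by blast
  show ?case
  proof (cases "?T s = 0")
    case True
    then show ?thesis using U0 by simp
  next
    case False
    have step: "cmod (gen_vdm e g s \<eta>) \<le> U / ?T s" if "\<And>j. j < s \<Longrightarrow> \<eta> j \<in> K" for \<eta>
    proof -
      have "cmod (gen_vdm e g (Suc s) (\<eta>(s := x))) \<le> U" if "x \<in> K" for x
        using that \<open>\<And>j. j < s \<Longrightarrow> \<eta> j \<in> K\<close> by (intro Suc.prems(4)) (auto simp: less_Suc_eq)
      from cmod_gen_vdm_mult_chebyshev_const_le[where e = e, OF inj this U0] show ?thesis
        using False T by (simp add: field_simps)
    qed
    then have "(\<Prod>j<s. ?T j) \<le> U / ?T s"
      using Suc.prems(2,3) step inj' by (intro Suc.IH) auto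
    then show ?thesis using False T by (simp add: field_simps)
  qed
qed

lemma cmod_gen_vdm_permute:
  assumes "p permutes {0..<s}"
  shows "cmod (gen_vdm e (g \<circ> p) s \<eta>) = cmod (gen_vdm e g s \<eta>)"
proof -
  let ?A = "Matrix.mat s s (\<lambda>(j, l). e (g j) (\<eta> l))"
  have "Matrix.mat s s (\<lambda>(j, l). e ((g \<circ> p) j) (\<eta> l)) = Matrix.mat s s (\<lambda>(i, j). ?A $$ (p i, j))"
    using permutes_in_image[OF assms] by (intro eq_matI) auto
  then have "gen_vdm e (g \<circ> p) s \<eta> = signof p * gen_vdm e g s \<eta>"
    unfolding gen_vdm_def using det_permute_rows[of ?A s p] assms by simp
  then show ?thesis by (simp add: norm_mult sign_def)
qed

text \<open>Two enumerations of \<open>B\<close> differ by a permutation of the rows, hence the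
  determinants by a sign. This permits the change from \<open>C_less\<close> to
  \<open>grlex_less\<close>.\<close>

lemma cmod_gen_vdm_bij_betw:
  assumes g: "bij_betw g {..<s} B" and h: "bij_betw h {..<s} B"
  shows "cmod (gen_vdm e h s \<eta>) = cmod (gen_vdm e g s \<eta>)"
proof -
  \<comment> \<open>Extended by the identity beyond \<open>s\<close>, as \<open>permutes\<close>
    demands.\<close>
  define p where "p j = (if j < s then the_inv_into {..<s} g (h j) else j)" for j
  have "bij_betw (the_inv_into {..<s} g \<circ> h) {..<s} {..<s}"
    using bij_betw_trans[OF h bij_betw_the_inv_into[OF g]] .
  then have "bij_betw p {..<s} {..<s}"
    by (rule bij_betw_cong[THEN iffD1, rotated]) (simp add: p_def)
  then have p: "p permutes {0..<s}"
    unfolding lessThan_atLeast0 by (intro bij_imp_permutes) (auto simp: p_def)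
  have "g (p j) = h j" if "j < s" for j
    using that f_the_inv_into_f_bij_betw[OF g, of "h j"] bij_betwE[OF h] by (auto simp: p_def)
  then have "gen_vdm e h s \<eta> = gen_vdm e (g \<circ> p) s \<eta>"
    unfolding gen_vdm_def by (intro arg_cong[of _ _ Determinant.det] eq_matI) auto
  with cmod_gen_vdm_permute[OF p] show ?thesis by metis
qed

lemma finite_strict_enumeration:
  assumes "finite A" and irrefl: "\<And>x. \<not> R x x" and trans: "\<And>x y z. R x y \<Longrightarrow> R y z \<Longrightarrow> R x z"
    and total: "\<And>x y. x \<noteq> y \<Longrightarrow> R x y \<or> R y x"
  shows "\<exists>g. bij_betw g {..<card A} A \<and> (\<forall>j<card A. g ` {..<j} = {b \<in> A. R b (g j)})"
  using \<open>finite A\<close>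
proof (induction "card A" arbitrary: A)
  case 0
  then show ?case by (intro exI[of _ undefined]) (simp add: bij_betw_def)
next
  case (Suc n)
  have "A \<noteq> {}" using Suc.hyps(2) by auto
  then obtain m where m: "m \<in> A" "\<And>x. x \<in> A \<Longrightarrow> x \<noteq> m \<Longrightarrow> \<not> R m x"
    using Finite_Set.bex_max_element[OF Suc.prems, of R] irrefl trans
    by (metis (no_types, lifting) asymp_onI transp_onI)
  have card: "card (A - {m}) = n" using m(1) Suc.hyps(2) Suc.prems by simp
  obtain g where g: "bij_betw g {..<n} (A - {m})"
    "\<And>j. j < n \<Longrightarrow> g ` {..<j} = {b \<in> A - {m}. R b (g j)}"
    using Suc.hyps(1)[of "A - {m}"] card Suc.prems by auto
  have img: "g(n := m) ` {..<j} = g ` {..<j}" if "j \<le> n" for j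
    using that by (intro image_cong) auto
  have "bij_betw (g(n := m)) {..<n} (A - {m})"
    using g(1) by (rule bij_betw_cong[THEN iffD1, rotated]) simp
  then have "bij_betw (g(n := m)) {..<Suc n} A"
    using bij_betw_combine[of "g(n := m)" "{..<n}" "A - {m}" "{n}" "{m}"] m(1)
    by (simp add: lessThan_Suc insert_absorb bij_betw_def)
  moreover have "g(n := m) ` {..<j} = {b \<in> A. R b ((g(n := m)) j)}" if "j < Suc n" for j
  proof (cases "j = n")
    case True
    then show ?thesis
      using img[of n] g(1) m total irrefl by (auto simp: bij_betw_def)
  next
    case False
    with that have j: "j < n" by simp
    then have "\<not> R m (g j)" using m(2)[of "g j"] bij_betwE[OF g(1)] by auto
    then show ?thesis using img[of j] g(2)[OF j] j by auto
  qed
  ultimately show ?case using Suc.hyps(2) by (metis)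
qed

section \<open>Lattice points of a convex body\<close>

lemma real_vec_add: "real_vec (\<alpha> + \<beta>) = real_vec \<alpha> + real_vec \<beta>"
  by (simp add: real_vec_def Finite_Cartesian_Product.vec_eq_iff)

lemma real_vec_0 [simp]: "real_vec 0 = 0"
  by (simp add: real_vec_def Finite_Cartesian_Product.vec_eq_iff)

lemma mdeg_add: "mdeg (\<alpha> + \<beta>) = mdeg \<alpha> + mdeg \<beta>"
  by (simp add: mdeg_def sum.distrib)

lemma mdeg_0 [simp]: "mdeg 0 = 0"
  by (simp add: mdeg_def)

lemma mpow_0 [simp]: "mpow z 0 = 1"
  by (simp add: mpow_def)

lemma mpow_add: "mpow z (\<alpha> + \<beta>) = mpow z \<alpha> * mpow z \<beta>"
  by (simp add: mpow_def power_add prod.distrib)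

lemma cmod_mpow_le:
  assumes "\<And>i. cmod (vec_nth z i) \<le> R"
  shows "cmod (mpow z \<alpha>) \<le> R ^ mdeg \<alpha>"
  unfolding mpow_def mdeg_def prod_norm[symmetric] power_sum norm_power
  by (intro prod_mono conjI power_mono norm_ge_zero zero_le_power assms)

lemma grlex_less_add: "grlex_less \<alpha> \<beta> \<Longrightarrow> grlex_less (\<alpha> + \<gamma>) (\<beta> + \<gamma>)"
  by (auto simp: grlex_less_def mdeg_add)

lemma grlex_less_add_mono:
  "(\<alpha> = \<alpha>' \<or> grlex_less \<alpha> \<alpha>') \<Longrightarrow> grlex_less \<beta> \<beta>' \<Longrightarrow> grlex_less (\<alpha> + \<beta>) (\<alpha>' + \<beta>')"
  by (metis add.commute grlex_less_add grlex_less_trans)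

lemma card_box:
  "finite {\<delta> :: nat ^ 'n. \<forall>i. vec_nth \<delta> i < j}"
  "card {\<delta> :: nat ^ 'n. \<forall>i. vec_nth \<delta> i < j} = j ^ CARD('n)"
proof -
  have "bij_betw vec_nth {\<delta> :: nat ^ 'n. \<forall>i. vec_nth \<delta> i < j} (PiE UNIV (\<lambda>_. {..<j}))"
    by (intro bij_betwI[where g = vec_lambda]) (auto simp: PiE_def)
  moreover have "finite (PiE (UNIV :: 'n set) (\<lambda>_. {..<j}))"
    by (intro finite_PiE) auto
  ultimately show "finite {\<delta> :: nat ^ 'n. \<forall>i. vec_nth \<delta> i < j}"
    "card {\<delta> :: nat ^ 'n. \<forall>i. vec_nth \<delta> i < j} = j ^ CARD('n)"
    by (auto simp: bij_betw_finite bij_betw_same_card card_PiE)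
qed

locale lattice_body =
  fixes C :: "(real ^ 'n::{finite,linorder}) set"
  assumes compact: "compact C" and convex: "convex C"
    and nonneg: "C \<subseteq> nonneg_orthant" and simplex: "std_simplex_Rn \<subseteq> C"
begin

lemma zero_mem: "0 \<in> C"
  using simplex by (auto simp: std_simplex_Rn_def)

text \<open>The average of \<open>x\<close> and \<open>y\<close> with weights
  \<open>k / (k + l)\<close> and \<open>l / (k + l)\<close> lies in \<open>C\<close> by convexity;
  the weights make no sense for \<open>k + l = 0\<close>.\<close>

lemma lattice_pts_add:
  assumes "\<alpha> \<in> lattice_pts C k" "\<beta> \<in> lattice_pts C l"
  shows "\<alpha> + \<beta> \<in> lattice_pts C (k + l)"
proof (cases "k + l = 0")
  case True
  then show ?thesis using assms by (auto simp: lattice_pts_def real_vec_add)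
next
  case False
  obtain x y where x: "x \<in> C" "real_vec \<alpha> = real k *\<^sub>R x" and y: "y \<in> C" "real_vec \<beta> = real l *\<^sub>R y"
    using assms by (auto simp: lattice_pts_def)
  define t where "t = real (k + l)"
  have t: "t > 0" using False unfolding t_def of_nat_0_less_iff by simp
  have "(real k / t) *\<^sub>R x + (real l / t) *\<^sub>R y \<in> C"
    using t x y by (intro convexD[OF convex]) (auto simp: t_def simp flip: add_divide_distrib)
  moreover have "real_vec (\<alpha> + \<beta>) = t *\<^sub>R ((real k / t) *\<^sub>R x + (real l / t) *\<^sub>R y)"
    using t by (simp add: real_vec_add x y scaleR_right_distrib)
  ultimately show ?thesis by (auto simp: lattice_pts_def t_def)
qed

lemma mdeg_le_imp_lattice_pts:
  assumes "mdeg \<delta> \<le> l"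
  shows "\<delta> \<in> lattice_pts C l"
proof (cases "l = 0")
  case True
  then have "\<delta> = 0" using assms by (simp add: mdeg_def Finite_Cartesian_Product.vec_eq_iff)
  then show ?thesis using zero_mem True by (auto simp: lattice_pts_def)
next
  case False
  have "(\<Sum>i\<in>UNIV. real (vec_nth \<delta> i)) \<le> real l"
    using assms unfolding mdeg_def by (metis of_nat_le_iff of_nat_sum)
  then have "(1 / real l) *\<^sub>R real_vec \<delta> \<in> std_simplex_Rn"
    using False by (simp add: std_simplex_Rn_def real_vec_def flip: sum_divide_distrib)
  then have "(1 / real l) *\<^sub>R real_vec \<delta> \<in> C" using simplex by blast
  moreover have "real_vec \<delta> = real l *\<^sub>R ((1 / real l) *\<^sub>R real_vec \<delta>)" using False by simp
  ultimately show ?thesis unfolding lattice_pts_def by blast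
qed

lemma zero_mem_lattice_pts: "0 \<in> lattice_pts C k"
  by (simp add: mdeg_le_imp_lattice_pts)

lemma lattice_pts_mono:
  assumes "k \<le> l" shows "lattice_pts C k \<subseteq> lattice_pts C l"
proof
  fix \<alpha> assume "\<alpha> \<in> lattice_pts C k"
  from lattice_pts_add[OF this zero_mem_lattice_pts[of "l - k"]] assms
  show "\<alpha> \<in> lattice_pts C l" by simp
qed

lemma obtain_box:
  obtains c :: nat where "c > 0"
    "\<And>k \<alpha> i. \<alpha> \<in> lattice_pts C k \<Longrightarrow> vec_nth \<alpha> i \<le> c * k"
proof -
  obtain B where B: "\<And>x. x \<in> C \<Longrightarrow> norm x \<le> B"
    using compact_imp_bounded[OF compact] by (auto simp: bounded_iff)
  define c where "c = Suc (nat \<lceil>B\<rceil>)"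
  have "vec_nth \<alpha> i \<le> c * k" if "\<alpha> \<in> lattice_pts C k" for k \<alpha> i
  proof -
    obtain x where x: "x \<in> C" "real_vec \<alpha> = real k *\<^sub>R x"
      using \<open>\<alpha> \<in> lattice_pts C k\<close> by (auto simp: lattice_pts_def)
    have "real (vec_nth \<alpha> i) = real k * vec_nth x i"
      using arg_cong[OF x(2), of "\<lambda>v. vec_nth v i"] by (simp add: real_vec_def)
    also have "\<dots> \<le> real k * real c"
    proof (intro mult_left_mono)
      have "vec_nth x i \<le> B"
        using component_le_norm_cart[of x i] B[OF x(1)] by linarith
      then show "vec_nth x i \<le> real c" unfolding c_def by linarith
    qed simp
    finally show ?thesis by (metis mult.commute of_nat_le_iff of_nat_mult)
  qed
  then show ?thesis using that[of c] by (simp add: c_def)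
qed

lemma finite_lattice_pts: "finite (lattice_pts C k)"
proof -
  obtain c where "\<And>\<alpha> i. \<alpha> \<in> lattice_pts C k \<Longrightarrow> vec_nth \<alpha> i \<le> c * k"
    using obtain_box by metis
  then have "lattice_pts C k \<subseteq> {\<delta>. \<forall>i. vec_nth \<delta> i < Suc (c * k)}"
    by (auto simp: less_Suc_eq_le)
  then show ?thesis using card_box(1) by (rule finite_subset)
qed

lemma M_num_pos: "M_num C k > 0"
  using zero_mem_lattice_pts[of k] finite_lattice_pts by (auto simp: M_num_def card_gt_0_iff)

section \<open>A Fekete lemma for superadditive functions on lattice points\<close>

definition superadditive :: "(nat \<Rightarrow> nat ^ 'n::{finite,linorder} \<Rightarrow> real) \<Rightarrow> bool" where
  "superadditive \<psi> \<longleftrightarrow>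
     (\<forall>k. \<forall>\<alpha>\<in>lattice_pts C k. 0 \<le> \<psi> k \<alpha>) \<and>
     (\<forall>k l. \<forall>\<alpha>\<in>lattice_pts C k. \<forall>\<beta>\<in>lattice_pts C l. \<psi> k \<alpha> + \<psi> l \<beta> \<le> \<psi> (k + l) (\<alpha> + \<beta>))"

lemma superadditive_multiple:
  assumes \<psi>: "superadditive \<psi>" and \<alpha>: "\<alpha> \<in> lattice_pts C m"
  shows "j *s \<alpha> \<in> lattice_pts C (j * m) \<and> real j * \<psi> m \<alpha> \<le> \<psi> (j * m) (j *s \<alpha>)"
proof (induction j)
  case 0
  then show ?case
    using \<psi> zero_mem_lattice_pts[of 0] by (auto simp: superadditive_def)
next
  case (Suc j)
  have eq: "Suc j *s \<alpha> = \<alpha> + j *s \<alpha>"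
    by (simp add: Finite_Cartesian_Product.vec_eq_iff)
  have "Suc j *s \<alpha> \<in> lattice_pts C (m + j * m)"
    unfolding eq using Suc \<alpha> by (intro lattice_pts_add) auto
  moreover have "\<psi> m \<alpha> + \<psi> (j * m) (j *s \<alpha>) \<le> \<psi> (m + j * m) (Suc j *s \<alpha>)"
    unfolding eq using Suc \<alpha> \<psi> unfolding superadditive_def by blast
  ultimately show ?case using Suc by (simp add: algebra_simps)
qed

text \<open>The boxes \<open>j\<alpha> + [0, j)\<^sup>N\<close>, \<open>\<alpha> \<in> mC\<close>, are disjoint, and contained in \<open>nC\<close> because
  \<open>[0, j)\<^sup>N \<subseteq> jN\<Sigma> \<subseteq> jNC\<close>.\<close>

lemma superadditive_sum_le:
  fixes \<psi> :: "nat \<Rightarrow> nat ^ 'n::{finite,linorder} \<Rightarrow> real"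
  assumes \<psi>: "superadditive \<psi>" and n: "j * (m + CARD('n)) \<le> n"
  shows "real j ^ Suc CARD('n) * (\<Sum>\<alpha>\<in>lattice_pts C m. \<psi> m \<alpha>) \<le> (\<Sum>\<beta>\<in>lattice_pts C n. \<psi> n \<beta>)"
proof -
  define D where "D = {\<delta> :: nat ^ 'n::{finite,linorder}. \<forall>i. vec_nth \<delta> i < j}"
  let ?f = "\<lambda>(\<alpha>, \<delta>). j *s \<alpha> + \<delta> :: nat ^ 'n::{finite,linorder}"
  let ?P = "lattice_pts C m \<times> D"
  have inj: "inj_on ?f ?P"
  proof (intro inj_onI, clarify)
    fix \<alpha> \<delta> \<alpha>' \<delta>'
    assume D: "\<delta> \<in> D" "\<delta>' \<in> D" and eq: "j *s \<alpha> + \<delta> = j *s \<alpha>' + \<delta>'"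
    have "vec_nth \<alpha> i = vec_nth \<alpha>' i \<and> vec_nth \<delta> i = vec_nth \<delta>' i" for i
    proof -
      have *: "j * vec_nth \<alpha> i + vec_nth \<delta> i = j * vec_nth \<alpha>' i + vec_nth \<delta>' i"
        using arg_cong[OF eq, of "\<lambda>v. vec_nth v i"] by simp
      have lt: "vec_nth \<delta> i < j" "vec_nth \<delta>' i < j" using D by (auto simp: D_def)
      \<comment> \<open>In each coordinate, \<open>\<alpha>\<close> and \<open>\<delta>\<close> are
        the quotient and the remainder on division by \<open>j\<close>.\<close>
      show ?thesis
        using arg_cong[OF *, of "\<lambda>v. v div j"] arg_cong[OF *, of "\<lambda>v. v mod j"] lt by simp
    qed
    then show "\<alpha> = \<alpha>' \<and> \<delta> = \<delta>'" by (simp add: Finite_Cartesian_Product.vec_eq_iff)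
  qed
  have mem: "j *s \<alpha> + \<delta> \<in> lattice_pts C n \<and> real j * \<psi> m \<alpha> \<le> \<psi> n (j *s \<alpha> + \<delta>)"
    if \<alpha>: "\<alpha> \<in> lattice_pts C m" and \<delta>: "\<delta> \<in> D" for \<alpha> \<delta>
  proof -
    \<comment> \<open>What remains of \<open>n\<close> after \<open>j * m\<close>; it is large
      enough to hold the whole box of side \<open>j\<close>.\<close>
    define l where "l = n - j * m"
    have l: "j * m + l = n" "j * CARD('n) \<le> l" using n by (auto simp: l_def algebra_simps)
    have "mdeg \<delta> \<le> (\<Sum>i\<in>(UNIV :: 'n set). j)"
      unfolding mdeg_def using \<delta> by (intro sum_mono) (auto simp: D_def less_imp_le)
    then have "\<delta> \<in> lattice_pts C l"
      using l by (intro mdeg_le_imp_lattice_pts) (simp add: mult.commute)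
    with superadditive_multiple[OF \<psi> \<alpha>, of j] \<psi>
    have "j *s \<alpha> + \<delta> \<in> lattice_pts C (j * m + l)" "0 \<le> \<psi> l \<delta>"
      "\<psi> (j * m) (j *s \<alpha>) + \<psi> l \<delta> \<le> \<psi> (j * m + l) (j *s \<alpha> + \<delta>)"
      by (auto simp: superadditive_def intro: lattice_pts_add)
    then show ?thesis using superadditive_multiple[OF \<psi> \<alpha>, of j] l by auto
  qed
  \<comment> \<open>One factor \<open>j\<close> comes from superadditivity, the other
    \<open>CARD('n)\<close> factors count the points of a box.\<close>
  have "real j ^ Suc CARD('n) * (\<Sum>\<alpha>\<in>lattice_pts C m. \<psi> m \<alpha>) =
      (\<Sum>\<alpha>\<in>lattice_pts C m. \<Sum>\<delta>\<in>D. real j * \<psi> m \<alpha>)"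
    by (simp add: D_def card_box sum_distrib_left algebra_simps)
  also have "\<dots> = (\<Sum>(\<alpha>, \<delta>)\<in>?P. real j * \<psi> m \<alpha>)"
    by (rule sum.cartesian_product)
  also have "\<dots> \<le> (\<Sum>x\<in>?P. \<psi> n (?f x))"
    using mem by (intro sum_mono) auto
  also have "\<dots> = sum (\<psi> n) (?f ` ?P)"
    by (simp add: sum.reindex[OF inj])
  \<comment> \<open>The points outside the boxes are added here, by nonnegativity of
    \<open>\<psi>\<close>.\<close>
  also have "\<dots> \<le> sum (\<psi> n) (lattice_pts C n)"
    using mem \<psi> by (intro sum_mono2 finite_lattice_pts) (auto simp: superadditive_def)
  finally show ?thesis .
qed

text \<open>The shift by \<open>CARD('n)\<close> matches the condition
  \<open>j * (m + CARD('n)) \<le> n\<close> of the box estimate, so that the resulting lower bounds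
  tend to exactly \<open>normalized_sum \<psi> m\<close>.\<close>

definition normalized_sum :: "(nat \<Rightarrow> nat ^ 'n::{finite,linorder} \<Rightarrow> real) \<Rightarrow> nat \<Rightarrow> real" where
  "normalized_sum \<psi> n = (\<Sum>\<alpha>\<in>lattice_pts C n. \<psi> n \<alpha>) / real (n + CARD('n)) ^ Suc CARD('n)"

text \<open>By the box estimate with \<open>j = n div (m + CARD('n))\<close>, the sequence
  eventually exceeds every number below one of its terms. The supremum may be infinite, hence
  \<open>ereal\<close>.\<close>

lemma normalized_sum_tendsto:
  assumes \<psi>: "superadditive \<psi>"
  shows "(\<lambda>n. ereal (normalized_sum \<psi> n)) \<longlonglongrightarrow> (SUP m. ereal (normalized_sum \<psi> m))"
proof (rule order_tendstoI)
  fix y assume "y < (SUP m. ereal (normalized_sum \<psi> m))"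
  then obtain m where m: "y < ereal (normalized_sum \<psi> m)"
    by (auto simp: less_SUP_iff)
  define N where "N = CARD('n)"
  define S where "S n = (\<Sum>\<alpha>\<in>lattice_pts C n. \<psi> n \<alpha>)" for n
  have N: "N > 0" by (simp add: N_def)
  have S0: "S m \<ge> 0" unfolding S_def using \<psi> by (intro sum_nonneg) (auto simp: superadditive_def)
  \<comment> \<open>A minorant in closed form: the integer quotient is replaced by the true quotient
    minus 1.\<close>
  let ?r = "\<lambda>n. ((real n / real (m + N) - 1) / real (n + N)) ^ Suc N * S m"
  have "(\<lambda>n. (real n / real (m + N) - 1) / real (n + N)) \<longlonglongrightarrow> 1 / real (m + N)"
    using N by (real_asymp simp: field_simps)
  then have "?r \<longlonglongrightarrow> (1 / real (m + N)) ^ Suc N * S m"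
    by (intro tendsto_mult_right tendsto_power)
  moreover have "(1 / real (m + N)) ^ Suc N * S m = normalized_sum \<psi> m"
    by (simp add: normalized_sum_def S_def N_def power_divide)
  ultimately have "(\<lambda>n. ereal (?r n)) \<longlonglongrightarrow> ereal (normalized_sum \<psi> m)"
    by simp
  then have "\<forall>\<^sub>F n in sequentially. y < ereal (?r n)"
    using m order_tendstoD(1) by blast
  moreover have "\<forall>\<^sub>F n in sequentially. ?r n \<le> normalized_sum \<psi> n"
    using eventually_ge_at_top[of "m + N"]
  proof eventually_elim
    case (elim n)
    define j where "j = n div (m + N)"
    have "real n / real (m + N) - 1 \<le> real j"
    proof -
      have "n < Suc j * (m + N)"
        using div_less_iff_less_mult[of "m + N" n "Suc j"] N by (simp add: j_def)
      then have "real n < real (Suc j) * real (m + N)"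
        by (metis of_nat_less_iff of_nat_mult)
      then show ?thesis using N by (simp add: field_simps)
    qed
    \<comment> \<open>Keeps the base in \<open>?r n\<close> nonnegative, as monotonicity of powers
      requires.\<close>
    moreover have "real n / real (m + N) \<ge> 1" using elim N by (simp add: field_simps)
    ultimately have "?r n \<le> (real j / real (n + N)) ^ Suc N * S m"
      using S0 N by (intro mult_right_mono power_mono divide_right_mono divide_nonneg_nonneg) auto
    also have "\<dots> = real j ^ Suc N * S m / real (n + N) ^ Suc N"
      by (simp add: power_divide)
    also have "\<dots> \<le> S n / real (n + N) ^ Suc N"
      unfolding S_def N_def
      by (intro divide_right_mono superadditive_sum_le[OF \<psi>]) (simp_all add: j_def N_def)
    finally show ?case by (simp add: normalized_sum_def S_def N_def)
  qed
  ultimately show "\<forall>\<^sub>F n in sequentially. y < ereal (normalized_sum \<psi> n)"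
    by eventually_elim (meson ereal_less_eq(3) less_le_trans)
next
  fix y assume "(SUP m. ereal (normalized_sum \<psi> m)) < y"
  then show "\<forall>\<^sub>F n in sequentially. ereal (normalized_sum \<psi> n) < y"
    by (intro always_eventually allI) (meson SUP_upper UNIV_I le_less_trans)
qed

end

section \<open>Products of graded lexicographic monic polynomials\<close>

definition grlex_cheb ::
    "(real ^ 'n::{finite,linorder}) set \<Rightarrow> (complex ^ 'n::{finite,linorder}) set \<Rightarrow> nat \<Rightarrow>
      nat ^ 'n::{finite,linorder} \<Rightarrow> real" where
  "grlex_cheb C K k \<alpha> =
     chebyshev_const (\<lambda>\<alpha> z. mpow z \<alpha>) K {\<beta> \<in> lattice_pts C k. grlex_less \<beta> \<alpha>} \<alpha>"

lemma VDM_eq_gen_vdm: "VDM C s \<eta> = gen_vdm (\<lambda>\<alpha> z. mpow z \<alpha>) (C_enum C) s \<eta>"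
  by (simp add: VDM_def gen_vdm_def)

context lattice_body
begin

text \<open>The product of the two polynomials is again monic because \<open>grlex_less\<close> is
  compatible with addition. Both index sets are tracked, since predecessors of
  \<open>\<alpha>\<close> need not lie in \<open>lattice_pts C k\<close>;
  \<open>lattice_pts_add\<close> keeps the product inside
  \<open>lattice_pts C (k + l)\<close>.\<close>

lemma monic_bounds_mult:
  assumes \<alpha>: "\<alpha> \<in> lattice_pts C k" and \<beta>: "\<beta> \<in> lattice_pts C l"
    and c: "c \<in> monic_bounds (\<lambda>\<alpha> z. mpow z \<alpha>) K {\<gamma> \<in> lattice_pts C k. grlex_less \<gamma> \<alpha>} \<alpha>"
    and d: "d \<in> monic_bounds (\<lambda>\<alpha> z. mpow z \<alpha>) K {\<gamma> \<in> lattice_pts C l. grlex_less \<gamma> \<beta>} \<beta>"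
  shows "c * d \<in> monic_bounds (\<lambda>\<alpha> z. mpow z \<alpha>) K
           {\<gamma> \<in> lattice_pts C (k + l). grlex_less \<gamma> (\<alpha> + \<beta>)} (\<alpha> + \<beta>)"
proof -
  define I where "I = insert \<alpha> {\<gamma> \<in> lattice_pts C k. grlex_less \<gamma> \<alpha>}"
  define J where "J = insert \<beta> {\<gamma> \<in> lattice_pts C l. grlex_less \<gamma> \<beta>}"
  define G where "G = insert (\<alpha> + \<beta>) {\<gamma> \<in> lattice_pts C (k + l). grlex_less \<gamma> (\<alpha> + \<beta>)}"
  have fin: "finite I" "finite J" "finite G"
    by (simp_all add: I_def J_def G_def finite_lattice_pts)
  obtain a where a: "a \<alpha> = 1" "\<And>z. z \<in> K \<Longrightarrow> cmod (\<Sum>\<gamma>\<in>I. a \<gamma> * mpow z \<gamma>) \<le> c"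
    using c by (auto simp: monic_bounds_def I_def)
  obtain b where b: "b \<beta> = 1" "\<And>z. z \<in> K \<Longrightarrow> cmod (\<Sum>\<gamma>\<in>J. b \<gamma> * mpow z \<gamma>) \<le> d"
    using d by (auto simp: monic_bounds_def J_def)
  \<comment> \<open>The coefficients of the product, by convolution.\<close>
  define h where "h \<gamma> = (\<Sum>x | x \<in> I \<times> J \<and> fst x + snd x = \<gamma>. a (fst x) * b (snd x))" for \<gamma>
  have less: "grlex_less (\<gamma> + \<delta>) (\<alpha> + \<beta>)" if "\<gamma> \<in> I" "\<delta> \<in> J" "(\<gamma>, \<delta>) \<noteq> (\<alpha>, \<beta>)" for \<gamma> \<delta>
    using that grlex_less_add_mono[of \<gamma> \<alpha> \<delta> \<beta>] grlex_less_add[of \<gamma> \<alpha> \<delta>]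
    by (auto simp: I_def J_def)
  have sub: "(\<lambda>x. fst x + snd x) ` (I \<times> J) \<subseteq> G"
  proof (clarsimp)
    fix \<gamma> \<delta> assume *: "\<gamma> \<in> I" "\<delta> \<in> J"
    then have "\<gamma> + \<delta> \<in> lattice_pts C (k + l)"
      using \<alpha> \<beta> by (intro lattice_pts_add) (auto simp: I_def J_def)
    then show "\<gamma> + \<delta> \<in> G" using less[OF *] by (auto simp: G_def)
  qed
  \<comment> \<open>Every other pair has a strictly smaller sum, so only the two leading terms
    produce the new leading term.\<close>
  have "{x. x \<in> I \<times> J \<and> fst x + snd x = \<alpha> + \<beta>} = {(\<alpha>, \<beta>)}"
    using less grlex_less_irrefl[of "\<alpha> + \<beta>"] by (auto simp: I_def J_def) metis+
  then have h1: "h (\<alpha> + \<beta>) = 1" by (simp add: h_def a b)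
  have prod: "(\<Sum>\<gamma>\<in>G. h \<gamma> * mpow z \<gamma>) =
      (\<Sum>\<gamma>\<in>I. a \<gamma> * mpow z \<gamma>) * (\<Sum>\<delta>\<in>J. b \<delta> * mpow z \<delta>)" for z
  proof -
    have "(\<Sum>\<gamma>\<in>G. h \<gamma> * mpow z \<gamma>) = (\<Sum>\<gamma>\<in>G. \<Sum>x | x \<in> I \<times> J \<and> fst x + snd x = \<gamma>.
        (a (fst x) * mpow z (fst x)) * (b (snd x) * mpow z (snd x)))"
      unfolding h_def sum_distrib_right
      by (intro sum.cong refl) (auto simp: mpow_add mult_ac)
    also have "\<dots> = (\<Sum>x\<in>I \<times> J. (a (fst x) * mpow z (fst x)) * (b (snd x) * mpow z (snd x)))"
      using fin sub by (intro sum.group) auto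
    also have "\<dots> = (\<Sum>\<gamma>\<in>I. a \<gamma> * mpow z \<gamma>) * (\<Sum>\<delta>\<in>J. b \<delta> * mpow z \<delta>)"
      unfolding sum_product sum.cartesian_product by (simp add: case_prod_beta)
    finally show ?thesis .
  qed
  have "cmod (\<Sum>\<gamma>\<in>G. h \<gamma> * mpow z \<gamma>) \<le> c * d" if "z \<in> K" for z
    unfolding prod norm_mult using a(2)[OF that] b(2)[OF that] monic_bounds_nonneg[OF c]
    by (intro mult_mono) auto
  then show ?thesis
    using h1 monic_bounds_nonneg[OF c] monic_bounds_nonneg[OF d]
    by (auto simp: monic_bounds_def G_def)
qed

section \<open>The enumeration by \<open>C_less\<close> and the dilates of \<open>C\<close>\<close>

lemma C_rad_set_nonempty: "{r. 0 \<le> r \<and> real_vec \<alpha> \<in> (\<lambda>x. r *\<^sub>R x) ` C} \<noteq> {}"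
  using mdeg_le_imp_lattice_pts[of \<alpha> "mdeg \<alpha>"] by (fastforce simp: lattice_pts_def)

text \<open>The infimum is attained because \<open>C\<close> is closed: the points
  \<open>real_vec \<alpha>\<close> divided by \<open>k + 1 / Suc n\<close> lie in \<open>C\<close>
  and converge to \<open>real_vec \<alpha>\<close> divided by \<open>k\<close>.\<close>

lemma C_rad_le_iff:
  assumes "k > 0"
  shows "C_rad C \<alpha> \<le> real k \<longleftrightarrow> \<alpha> \<in> lattice_pts C k"
proof
  assume "\<alpha> \<in> lattice_pts C k"
  then show "C_rad C \<alpha> \<le> real k"
    unfolding C_rad_def by (intro cInf_lower bdd_belowI[of _ 0]) (auto simp: lattice_pts_def)
next
  assume le: "C_rad C \<alpha> \<le> real k"
  have "(1 / (real k + 1 / real (Suc n))) *\<^sub>R real_vec \<alpha> \<in> C" for n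
  proof -
    define t where "t = real k + 1 / real (Suc n)"
    have t: "t > 0" using assms by (simp add: t_def add_pos_pos)
    have "Inf {r. 0 \<le> r \<and> real_vec \<alpha> \<in> (\<lambda>x. r *\<^sub>R x) ` C} < t"
      using le by (simp add: C_rad_def t_def add_strict_increasing2 le_less_trans)
    then obtain r x where r: "0 \<le> r" "r < t" "x \<in> C" "real_vec \<alpha> = r *\<^sub>R x"
      using cInf_lessD[OF C_rad_set_nonempty] by blast
    \<comment> \<open>\<open>C\<close> is convex and contains 0, so it contains the segment from 0
      to \<open>x\<close>.\<close>
    have "(r / t) *\<^sub>R x + (1 - r / t) *\<^sub>R 0 \<in> C"
      using r t zero_mem by (intro convexD[OF convex]) auto
    then show ?thesis using r by (simp add: t_def)
  qed
  moreover have "(\<lambda>n. (1 / (real k + 1 / real (Suc n))) *\<^sub>R real_vec \<alpha>) \<longlonglongrightarrow>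
      (1 / (real k + 0)) *\<^sub>R real_vec \<alpha>"
    using assms by (intro tendsto_intros LIMSEQ_Suc[OF lim_1_over_n]) auto
  ultimately have "(1 / (real k + 0)) *\<^sub>R real_vec \<alpha> \<in> C"
    by (rule closed_sequentially[OF compact_imp_closed[OF compact]])
  moreover have "real_vec \<alpha> = real k *\<^sub>R ((1 / (real k + 0)) *\<^sub>R real_vec \<alpha>)"
    using assms by simp
  ultimately show "\<alpha> \<in> lattice_pts C k" unfolding lattice_pts_def by blast
qed

lemma C_enum_less: "i < j \<Longrightarrow> C_less C (C_enum C i) (C_enum C j)"
  and range_C_enum: "range (C_enum C) = UNIV"
  using C_enum_increasing_enumeration[OF compact_imp_bounded[OF compact] simplex]
  by (auto simp: C_increasing_enumeration_def)

lemma inj_C_enum: "inj (C_enum C)"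
  using C_enum_less C_less_irrefl by (metis injI linorder_neqE_nat)

text \<open>Makes every one-point determinant equal to 1, which takes care of the arbitrary first
  Leja point.\<close>

lemma C_enum_0: "C_enum C 0 = 0"
proof -
  obtain i where i: "C_enum C i = 0" using range_C_enum by (metis UNIV_I imageE)
  have "C_rad C 0 = 0"
  proof -
    have "C_rad C 0 \<le> 0"
      unfolding C_rad_def using zero_mem by (intro cInf_lower bdd_belowI[of _ 0]) auto
    moreover have "0 \<le> C_rad C 0"
      unfolding C_rad_def by (intro cInf_greatest C_rad_set_nonempty) auto
    ultimately show ?thesis by simp
  qed
  moreover have "0 \<le> C_rad C \<alpha>" for \<alpha>
    unfolding C_rad_def by (intro cInf_greatest C_rad_set_nonempty) auto
  moreover have "\<not> grlex_less \<alpha> 0" for \<alpha> :: "nat ^ 'n::{finite,linorder}"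
    by (auto simp: grlex_less_def)
  ultimately have "\<not> C_less C \<alpha> 0" for \<alpha>
    by (auto simp: C_less_def not_less)
  then have "\<not> 0 < i" using C_enum_less[of 0 i] i by metis
  with i show ?thesis by simp
qed

text \<open>The enumeration is increasing in \<open>C_rad\<close>, so the indices of lattice points
  in \<open>kC\<close> form a finite initial segment, and counting gives its length.\<close>

lemma bij_betw_C_enum:
  assumes "k > 0"
  shows "bij_betw (C_enum C) {..<M_num C k} (lattice_pts C k)"
proof -
  define I where "I = {i. C_enum C i \<in> lattice_pts C k}"
  have bij: "bij_betw (C_enum C) I (lattice_pts C k)"
    unfolding I_def bij_betw_def
  proof
    show "inj_on (C_enum C) {i. C_enum C i \<in> lattice_pts C k}"
      using inj_C_enum by (rule inj_on_subset) simp
    show "C_enum C ` {i. C_enum C i \<in> lattice_pts C k} = lattice_pts C k"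
      using range_C_enum by (fastforce simp: image_iff dest: equalityD2)
  qed
  have down: "i \<in> I" if "i < j" "j \<in> I" for i j
  proof -
    have "C_rad C (C_enum C i) \<le> C_rad C (C_enum C j)"
      using C_enum_less[OF that(1)] by (auto simp: C_less_def)
    then show ?thesis
      using that(2) C_rad_le_iff[OF assms] by (auto simp: I_def intro: order_trans)
  qed
  have fin: "finite I" using bij finite_lattice_pts by (simp add: bij_betw_finite)
  have "I \<noteq> {}" using bij M_num_pos[of k] by (auto simp: bij_betw_def M_num_def)
  then have max: "Max I \<in> I" using fin by (rule Max_in[rotated])
  have "I = {..<Suc (Max I)}"
  proof (intro equalityI subsetI)
    show "i \<in> {..<Suc (Max I)}" if "i \<in> I" for i
      using Max_ge[OF fin that] by simp
    show "i \<in> I" if "i \<in> {..<Suc (Max I)}" for i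
      using that max down[OF _ max, of i] by (cases "i = Max I") auto
  qed
  moreover have "card I = M_num C k" using bij by (simp add: bij_betw_same_card M_num_def)
  ultimately have "I = {..<M_num C k}" by (metis card_lessThan)
  with bij show ?thesis by simp
qed

end

section \<open>Estimates for Vandermonde determinants on \<open>K\<close>\<close>

locale lattice_body_points = lattice_body C
  for C :: "(real ^ 'n::{finite,linorder}) set" +
  fixes K :: "(complex ^ 'n::{finite,linorder}) set" and R :: real
  assumes K_nonempty: "K \<noteq> {}" and R_pos: "R > 0"
    and R_bound: "\<And>z i. z \<in> K \<Longrightarrow> cmod (vec_nth z i) \<le> R"
begin

abbreviation (input) monom_fun :: "nat ^ 'n::{finite,linorder} \<Rightarrow> complex ^ 'n::{finite,linorder} \<Rightarrow> complex" where
  "monom_fun \<equiv> \<lambda>\<alpha> z. mpow z \<alpha>"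

lemma power_mdeg_in_monic_bounds: "finite B \<Longrightarrow> R ^ mdeg \<alpha> \<in> monic_bounds monom_fun K B \<alpha>"
  using R_pos by (intro bound_in_monic_bounds cmod_mpow_le R_bound) auto

lemma monic_bounds_nonempty: "finite B \<Longrightarrow> monic_bounds monom_fun K B \<alpha> \<noteq> {}"
  using power_mdeg_in_monic_bounds by blast

lemma grlex_monic_bounds_nonempty:
  "monic_bounds monom_fun K {\<beta> \<in> lattice_pts C k. grlex_less \<beta> \<alpha>} \<alpha> \<noteq> {}"
  by (intro monic_bounds_nonempty) (simp add: finite_lattice_pts)

lemma grlex_cheb_nonneg: "0 \<le> grlex_cheb C K k \<alpha>"
  unfolding grlex_cheb_def by (intro chebyshev_const_nonneg grlex_monic_bounds_nonempty)

lemma grlex_cheb_le: "grlex_cheb C K k \<alpha> \<le> R ^ mdeg \<alpha>"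
  unfolding grlex_cheb_def
  by (intro chebyshev_const_le power_mdeg_in_monic_bounds) (simp add: finite_lattice_pts)

text \<open>\<open>monic_bounds_mult\<close> is applied to arbitrary bounds \<open>c\<close> and
  \<open>d\<close>; the two infima are then taken one after the other.\<close>

lemma grlex_cheb_submultiplicative:
  assumes "\<alpha> \<in> lattice_pts C k" "\<beta> \<in> lattice_pts C l"
  shows "grlex_cheb C K (k + l) (\<alpha> + \<beta>) \<le> grlex_cheb C K k \<alpha> * grlex_cheb C K l \<beta>"
  unfolding grlex_cheb_def[of C K l]
proof (intro le_mult_chebyshev_const grlex_monic_bounds_nonempty grlex_cheb_nonneg)
  fix d assume d: "d \<in> monic_bounds monom_fun K {\<gamma> \<in> lattice_pts C l. grlex_less \<gamma> \<beta>} \<beta>"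
  have "grlex_cheb C K (k + l) (\<alpha> + \<beta>) \<le> d * grlex_cheb C K k \<alpha>"
    unfolding grlex_cheb_def[of C K k]
  proof (intro le_mult_chebyshev_const grlex_monic_bounds_nonempty monic_bounds_nonneg[OF d])
    fix c assume "c \<in> monic_bounds monom_fun K {\<gamma> \<in> lattice_pts C k. grlex_less \<gamma> \<alpha>} \<alpha>"
    from chebyshev_const_le[OF monic_bounds_mult[OF assms this d]]
    show "grlex_cheb C K (k + l) (\<alpha> + \<beta>) \<le> d * c"
      by (simp add: grlex_cheb_def mult.commute)
  qed
  then show "grlex_cheb C K (k + l) (\<alpha> + \<beta>) \<le> grlex_cheb C K k \<alpha> * d"
    by (simp add: mult.commute)
qed

definition cheb_prod :: "nat \<Rightarrow> real" where
  "cheb_prod k = (\<Prod>\<alpha>\<in>lattice_pts C k. grlex_cheb C K k \<alpha>)"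

lemma cheb_prod_nonneg: "0 \<le> cheb_prod k"
  unfolding cheb_prod_def by (intro prod_nonneg) (simp add: grlex_cheb_nonneg)

text \<open>For a graded lexicographic enumeration, the initial segments are exactly the index sets
  in \<open>grlex_cheb\<close>, so the product no longer refers to the enumeration.\<close>

lemma grlex_enumeration:
  obtains g where "bij_betw g {..<M_num C k} (lattice_pts C k)"
    "(\<Prod>j<M_num C k. chebyshev_const monom_fun K (g ` {..<j}) (g j)) = cheb_prod k"
proof -
  have "\<exists>g. bij_betw g {..<card (lattice_pts C k)} (lattice_pts C k) \<and>
      (\<forall>j<card (lattice_pts C k). g ` {..<j} = {\<beta> \<in> lattice_pts C k. grlex_less \<beta> (g j)})"
    by (rule finite_strict_enumeration[OF finite_lattice_pts])
      (fact grlex_less_irrefl, erule (1) grlex_less_trans, erule grlex_less_total)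
  then obtain g where g: "bij_betw g {..<M_num C k} (lattice_pts C k)"
    "\<forall>j<M_num C k. g ` {..<j} = {\<beta> \<in> lattice_pts C k. grlex_less \<beta> (g j)}"
    unfolding M_num_def by blast
  have "(\<Prod>j<M_num C k. chebyshev_const monom_fun K (g ` {..<j}) (g j)) =
      (\<Prod>j<M_num C k. grlex_cheb C K k (g j))"
    using g(2) by (intro prod.cong) (simp_all add: grlex_cheb_def)
  also have "\<dots> = cheb_prod k"
    unfolding cheb_prod_def by (rule prod.reindex_bij_betw[OF g(1)])
  finally show ?thesis using that g(1) by blast
qed

lemma cmod_VDM_le_cheb_prod:
  assumes "k > 0" and "\<And>j. j < M_num C k \<Longrightarrow> \<eta> j \<in> K"
  shows "cmod (VDM C (M_num C k) \<eta>) \<le> fact (M_num C k) * cheb_prod k"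
proof -
  obtain g where g: "bij_betw g {..<M_num C k} (lattice_pts C k)"
    "(\<Prod>j<M_num C k. chebyshev_const monom_fun K (g ` {..<j}) (g j)) = cheb_prod k"
    using grlex_enumeration by blast
  have "cmod (VDM C (M_num C k) \<eta>) = cmod (gen_vdm monom_fun g (M_num C k) \<eta>)"
    unfolding VDM_eq_gen_vdm by (rule cmod_gen_vdm_bij_betw[OF g(1) bij_betw_C_enum[OF assms(1)]])
  also have "\<dots> \<le> fact (M_num C k) * cheb_prod k"
    unfolding g(2)[symmetric] using g(1) assms(2)
    by (intro cmod_gen_vdm_le) (auto simp: bij_betw_def monic_bounds_nonempty)
  finally show ?thesis .
qed

lemma cheb_prod_le:
  assumes "k > 0"
    and U: "\<And>\<eta>. (\<And>j. j < M_num C k \<Longrightarrow> \<eta> j \<in> K) \<Longrightarrow> cmod (VDM C (M_num C k) \<eta>) \<le> U"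
  shows "cheb_prod k \<le> U"
proof -
  obtain g where g: "bij_betw g {..<M_num C k} (lattice_pts C k)"
    "(\<Prod>j<M_num C k. chebyshev_const monom_fun K (g ` {..<j}) (g j)) = cheb_prod k"
    using grlex_enumeration by blast
  have "cmod (gen_vdm monom_fun g (M_num C k) \<eta>) = cmod (VDM C (M_num C k) \<eta>)" for \<eta>
    unfolding VDM_eq_gen_vdm by (rule cmod_gen_vdm_bij_betw[OF bij_betw_C_enum[OF assms(1)] g(1)])
  then show ?thesis
    unfolding g(2)[symmetric] using g(1) U K_nonempty
    by (intro prod_chebyshev_const_le) (auto simp: bij_betw_def monic_bounds_nonempty)
qed

lemma cmod_VDM_le_V_max:
  assumes "k > 0" and "\<And>j. j < M_num C k \<Longrightarrow> \<eta> j \<in> K"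
  shows "cmod (VDM C (M_num C k) \<eta>) \<le> V_max C K k"
  unfolding V_max_def
proof (rule cSUP_upper)
  show "\<eta> \<in> {\<eta>. \<forall>j<M_num C k. \<eta> j \<in> K}" using assms(2) by simp
  \<comment> \<open>A real \<open>SUP\<close> is meaningful only with a bound, here the one by
    Chebyshev constants.\<close>
  show "bdd_above ((\<lambda>\<eta>. cmod (VDM C (M_num C k) \<eta>)) ` {\<eta>. \<forall>j<M_num C k. \<eta> j \<in> K})"
    using cmod_VDM_le_cheb_prod[OF assms(1)] by (intro bdd_aboveI2) blast
qed

lemma V_max_le:
  assumes "\<And>\<eta>. (\<And>j. j < M_num C k \<Longrightarrow> \<eta> j \<in> K) \<Longrightarrow> cmod (VDM C (M_num C k) \<eta>) \<le> U"
  shows "V_max C K k \<le> U"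
proof -
  obtain x where "x \<in> K" using K_nonempty by blast
  then have "(\<lambda>_. x) \<in> {\<eta>. \<forall>j<M_num C k. \<eta> j \<in> K}" by simp
  then show ?thesis
    unfolding V_max_def by (intro cSUP_least assms) auto
qed

lemma V_max_nonneg:
  assumes "k > 0"
  shows "0 \<le> V_max C K k"
proof -
  obtain x where "x \<in> K" using K_nonempty by blast
  then have "cmod (VDM C (M_num C k) (\<lambda>_. x)) \<le> V_max C K k"
    using assms by (intro cmod_VDM_le_V_max)
  then show ?thesis using norm_ge_zero order_trans by blast
qed

text \<open>A Leja point maximizes over the last argument, so each step gains at least one Chebyshev
  constant. The order must be that of \<open>C_enum\<close>, since all initial segments of the
  enumeration enter the Leja condition.\<close>

lemma Leja_prod_le:
  assumes Leja: "C_Leja C K \<zeta>"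
  shows "(\<Prod>j<s. chebyshev_const monom_fun K (C_enum C ` {..<j}) (C_enum C j)) \<le> cmod (VDM C s \<zeta>)"
proof (induction s)
  case 0
  then show ?case by (simp add: VDM_eq_gen_vdm)
next
  case (Suc s)
  let ?T = "\<lambda>j. chebyshev_const monom_fun K (C_enum C ` {..<j}) (C_enum C j)"
  have inj: "inj_on (C_enum C) A" for A using inj_C_enum by (rule inj_on_subset) simp
  have "cmod (VDM C s \<zeta>) * ?T s \<le> cmod (VDM C (Suc s) \<zeta>)"
    unfolding VDM_eq_gen_vdm
  proof (rule cmod_gen_vdm_mult_chebyshev_const_le[OF inj])
    fix x assume x: "x \<in> K"
    show "cmod (gen_vdm monom_fun (C_enum C) (Suc s) (\<zeta>(s := x))) \<le>
        cmod (gen_vdm monom_fun (C_enum C) (Suc s) \<zeta>)"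
    \<comment> \<open>The Leja condition says nothing about the first point, but the determinant of
      one point is constantly 1.\<close>
    proof (cases "s = 0")
      case True
      have "gen_vdm monom_fun (C_enum C) (Suc 0) \<eta> = 1" for \<eta>
        unfolding gen_vdm_def by (subst det_single) (auto simp: C_enum_0)
      then show ?thesis by (simp only: True)
    next
      case False
      have K: "\<zeta> j \<in> K" for j using Leja by (simp add: C_Leja_def)
      have "bdd_above ((\<lambda>\<eta>. cmod (VDM C (Suc s) (\<zeta>(s := \<eta>)))) ` K)"
        unfolding VDM_eq_gen_vdm
      proof (rule bdd_aboveI2)
        fix x assume "x \<in> K"
        with K show "cmod (gen_vdm monom_fun (C_enum C) (Suc s) (\<zeta>(s := x))) \<le>
            fact (Suc s) * (\<Prod>j<Suc s. ?T j)"
          by (intro cmod_gen_vdm_le inj monic_bounds_nonempty) auto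
      qed
      then have "cmod (VDM C (Suc s) (\<zeta>(s := x))) \<le> (SUP \<eta>\<in>K. cmod (VDM C (Suc s) (\<zeta>(s := \<eta>))))"
        using x by (intro cSUP_upper)
      also have "\<dots> = cmod (VDM C (Suc s) \<zeta>)"
        using Leja False by (simp add: C_Leja_def)
      finally show ?thesis by (simp add: VDM_eq_gen_vdm)
    qed
  qed simp
  moreover have "(\<Prod>j<s. ?T j) * ?T s \<le> cmod (VDM C s \<zeta>) * ?T s"
    by (intro mult_right_mono Suc chebyshev_const_nonneg monic_bounds_nonempty) simp
  ultimately show ?case by simp
qed

text \<open>The same product of constants, in the order of \<open>C_enum\<close>, bounds an
  arbitrary determinant from above up to the factorial and the Leja determinant from below.\<close>

lemma V_max_le_fact_mult_Leja:
  assumes "C_Leja C K \<zeta>"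
  shows "V_max C K k \<le> fact (M_num C k) * cmod (VDM C (M_num C k) \<zeta>)"
proof (rule V_max_le)
  fix \<eta> assume \<eta>: "\<And>j. j < M_num C k \<Longrightarrow> \<eta> j \<in> K"
  have "cmod (VDM C (M_num C k) \<eta>) \<le> fact (M_num C k) *
      (\<Prod>j<M_num C k. chebyshev_const monom_fun K (C_enum C ` {..<j}) (C_enum C j))"
    unfolding VDM_eq_gen_vdm using \<eta> inj_C_enum
    by (intro cmod_gen_vdm_le monic_bounds_nonempty inj_on_subset[OF inj_C_enum]) auto
  also have "\<dots> \<le> fact (M_num C k) * cmod (VDM C (M_num C k) \<zeta>)"
    by (intro mult_left_mono Leja_prod_le[OF assms]) simp
  finally show "cmod (VDM C (M_num C k) \<eta>) \<le> fact (M_num C k) * cmod (VDM C (M_num C k) \<zeta>)" .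
qed

end

section \<open>Growth of \<open>M_num\<close> and \<open>L_num\<close>\<close>

context lattice_body
begin

lemma M_num_le:
  obtains c :: nat where "c > 0" "\<And>k. M_num C k \<le> (c * k + 1) ^ CARD('n)"
    "\<And>k. L_num C k \<le> CARD('n) * (c * k) * M_num C k"
proof -
  obtain c where c: "c > 0" "\<And>k \<alpha> i. \<alpha> \<in> lattice_pts C k \<Longrightarrow> vec_nth \<alpha> i \<le> c * k"
    using obtain_box by metis
  have "M_num C k \<le> (c * k + 1) ^ CARD('n)" for k
  proof -
    have "lattice_pts C k \<subseteq> {\<delta>. \<forall>i. vec_nth \<delta> i < c * k + 1}"
      using c(2) by (auto simp: less_Suc_eq_le)
    from card_mono[OF card_box(1) this] show ?thesis
      by (simp only: M_num_def card_box)
  qed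
  moreover have "L_num C k \<le> CARD('n) * (c * k) * M_num C k" for k
  proof -
    have "mdeg \<alpha> \<le> CARD('n) * (c * k)" if "\<alpha> \<in> lattice_pts C k" for \<alpha>
      unfolding mdeg_def using c(2)[OF that] sum_bounded_above[of UNIV "vec_nth \<alpha>" "c * k"] by simp
    from sum_bounded_above[of "lattice_pts C k" mdeg, OF this] show ?thesis
      by (simp add: L_num_def M_num_def mult.commute)
  qed
  ultimately show ?thesis using that c(1) by blast
qed

lemma L_num_pos:
  assumes "k > 0" shows "L_num C k > 0"
proof -
  \<comment> \<open>A unit vector in an arbitrary direction.\<close>
  define \<alpha> :: "nat ^ 'n::{finite,linorder}" where "\<alpha> = axis undefined 1"
  have "mdeg \<alpha> = 1" by (simp add: mdeg_def \<alpha>_def axis_def)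
  moreover from this have "\<alpha> \<in> lattice_pts C k"
    using assms by (intro mdeg_le_imp_lattice_pts) simp
  then have "mdeg \<alpha> \<le> L_num C k"
    unfolding L_num_def by (rule member_le_sum) (simp_all add: finite_lattice_pts)
  ultimately show ?thesis by simp
qed

lemma superadditive_mdeg: "superadditive (\<lambda>k \<alpha>. real (mdeg \<alpha>))"
  by (simp add: superadditive_def mdeg_add)

lemma linear_power_le:
  assumes "c > 0"
  shows "real ((c * k + 1) ^ CARD('n)) \<le> real c ^ CARD('n) * real (k + CARD('n)) ^ CARD('n)"
proof -
  have "c * k + 1 \<le> c * (k + CARD('n))"
    using assms by (simp add: algebra_simps Suc_leI)
  then have "(c * k + 1) ^ CARD('n) \<le> (c * (k + CARD('n))) ^ CARD('n)" by (rule power_mono) simp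
  then have "real ((c * k + 1) ^ CARD('n)) \<le> real ((c * (k + CARD('n))) ^ CARD('n))"
    by (rule of_nat_mono)
  then show ?thesis by (simp only: of_nat_power of_nat_mult power_mult_distrib)
qed

text \<open>\<open>L_num\<close> is the sum of the superadditive function \<open>mdeg\<close>, so
  the limit is a supremum. It is finite by counting in a box and positive because the term with
  index 1 is.\<close>

lemma L_num_asymp:
  "\<exists>\<rho>>0. (\<lambda>k. real (L_num C k) / real (k + CARD('n)) ^ Suc CARD('n)) \<longlonglongrightarrow> \<rho>"
proof -
  define u where "u k = real (L_num C k) / real (k + CARD('n)) ^ Suc CARD('n)" for k
  have u: "u = normalized_sum (\<lambda>k \<alpha>. real (mdeg \<alpha>))"
    by (simp add: u_def normalized_sum_def L_num_def fun_eq_iff)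
  obtain c where c: "c > 0" "\<And>k. M_num C k \<le> (c * k + 1) ^ CARD('n)"
    "\<And>k. L_num C k \<le> CARD('n) * (c * k) * M_num C k"
    using M_num_le by metis
  have bound: "u k \<le> real CARD('n) * real c ^ Suc CARD('n)" for k
  proof -
    let ?s = "real (k + CARD('n))"
    have "real (L_num C k) \<le> real (CARD('n) * (c * k) * M_num C k)"
      using c(3) by (rule of_nat_mono)
    also have "\<dots> = real CARD('n) * (real c * real k) * real (M_num C k)"
      by (simp only: of_nat_mult)
    also have "\<dots> \<le> real CARD('n) * (real c * ?s) * (real c ^ CARD('n) * ?s ^ CARD('n))"
      using linear_power_le[OF c(1), of k] c(2)[of k]
      by (intro mult_mono) (auto intro: order_trans[OF of_nat_mono])
    also have "\<dots> = real CARD('n) * real c ^ Suc CARD('n) * ?s ^ Suc CARD('n)"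
      by (simp add: algebra_simps)
    finally have *: "real (L_num C k) \<le> real CARD('n) * real c ^ Suc CARD('n) * ?s ^ Suc CARD('n)" .
    have "0 < ?s ^ Suc CARD('n)" by (intro zero_less_power) (simp add: add_nonneg_pos)
    then show ?thesis unfolding u_def using * by (simp only: pos_divide_le_eq)
  qed
  define \<rho> where "\<rho> = (SUP m. ereal (u m))"
  have lim: "(\<lambda>k. ereal (u k)) \<longlonglongrightarrow> \<rho>"
    unfolding u \<rho>_def by (rule normalized_sum_tendsto[OF superadditive_mdeg])
  have "\<rho> \<le> ereal (real CARD('n) * real c ^ Suc CARD('n))"
    unfolding \<rho>_def using bound by (intro SUP_least) simp
  moreover have "ereal (u 1) \<le> \<rho>" unfolding \<rho>_def by (rule SUP_upper) simp
  moreover have "u 1 > 0"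
    unfolding u_def using L_num_pos[of 1] by (intro divide_pos_pos zero_less_power) (auto simp: add_pos_nonneg)
  ultimately obtain r where "\<rho> = ereal r" "r > 0"
    by (cases \<rho>) auto
  with lim show ?thesis unfolding u_def by auto
qed

text \<open>The quotient of two normalized sums, the lower one with positive finite limit. The
  infinite case is kept because it corresponds to transfinite diameter 0.\<close>

lemma superadditive_average_cases:
  assumes "superadditive \<psi>"
  obtains q where "(\<lambda>k. (\<Sum>\<alpha>\<in>lattice_pts C k. \<psi> k \<alpha>) / real (L_num C k)) \<longlonglongrightarrow> q"
  | "filterlim (\<lambda>k. (\<Sum>\<alpha>\<in>lattice_pts C k. \<psi> k \<alpha>) / real (L_num C k)) at_top sequentially"
proof -
  obtain \<rho> where \<rho>: "\<rho> > 0"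
    "(\<lambda>k. real (L_num C k) / real (k + CARD('n)) ^ Suc CARD('n)) \<longlonglongrightarrow> \<rho>" (is "?L \<longlonglongrightarrow> \<rho>")
    using L_num_asymp by blast
  let ?a = "\<lambda>k. (\<Sum>\<alpha>\<in>lattice_pts C k. \<psi> k \<alpha>) / real (L_num C k)"
  define U where "U = (SUP m. ereal (normalized_sum \<psi> m))"
  have lim: "(\<lambda>k. ereal (normalized_sum \<psi> k)) \<longlonglongrightarrow> U"
    unfolding U_def by (rule normalized_sum_tendsto[OF assms])
  have a: "?a = (\<lambda>k. normalized_sum \<psi> k / ?L k)"
    by (simp add: normalized_sum_def fun_eq_iff add_nonneg_eq_0_iff)
  have inv: "(\<lambda>k. inverse (?L k)) \<longlonglongrightarrow> inverse \<rho>"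
    using \<rho> by (intro tendsto_inverse) auto
  \<comment> \<open>Excludes the value minus infinity for \<open>U\<close>.\<close>
  have "ereal (normalized_sum \<psi> 0) \<le> U" unfolding U_def by (rule SUP_upper) simp
  then show ?thesis
  proof (cases U)
    case (real u)
    then have "(\<lambda>k. normalized_sum \<psi> k) \<longlonglongrightarrow> u" using lim by simp
    then have "?a \<longlonglongrightarrow> u / \<rho>" unfolding a using \<rho> by (intro tendsto_divide) auto
    then show ?thesis by (rule that(1))
  next
    case PInf
    then have "filterlim (normalized_sum \<psi>) at_top sequentially"
      using lim by (simp add: tendsto_PInfty_eq_at_top)
    then have "filterlim (\<lambda>k. inverse (?L k) * normalized_sum \<psi> k) at_top sequentially"
      using \<rho>(1) by (intro filterlim_tendsto_pos_mult_at_top[OF inv]) auto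
    then have "filterlim ?a at_top sequentially"
      unfolding a by (simp only: divide_inverse mult.commute)
    then show ?thesis by (rule that(2))
  qed simp
qed

text \<open>The logarithm of \<open>M!\<close> is at most \<open>M * ln M\<close>, of order at most
  \<open>k ^ N * ln k\<close>, whereas \<open>L_num\<close> grows like
  \<open>k ^ Suc N\<close>.\<close>

lemma fact_M_num_powr_tendsto: "(\<lambda>k. fact (M_num C k) powr (1 / real (L_num C k))) \<longlonglongrightarrow> 1"
proof -
  define N where "N = CARD('n)"
  have N: "N > 0" by (simp add: N_def)
  obtain c where c: "c > 0" "\<And>k. M_num C k \<le> (c * k + 1) ^ N"
    using M_num_le unfolding N_def by metis
  obtain \<rho> where \<rho>: "\<rho> > 0" "(\<lambda>k. real (L_num C k) / real (k + N) ^ Suc N) \<longlonglongrightarrow> \<rho>"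
    using L_num_asymp unfolding N_def by blast
  let ?L = "\<lambda>k. real (L_num C k) / real (k + N) ^ Suc N"
  let ?b = "\<lambda>k. real c ^ N * (real N * (ln (real c * real k + 1) / real (k + N)))"
  have "(\<lambda>k. ln (real c * real k + 1) / real (k + N)) \<longlonglongrightarrow> 0"
    using c(1) N by real_asymp
  then have "(\<lambda>k. ?b k / ?L k) \<longlonglongrightarrow> real c ^ N * (real N * 0) / \<rho>"
    using \<rho> by (intro tendsto_divide tendsto_mult_left) auto
  then have upper: "(\<lambda>k. ?b k / ?L k) \<longlonglongrightarrow> 0" by simp
  have "\<forall>\<^sub>F k in sequentially. ln (fact (M_num C k)) / real (L_num C k) \<le> ?b k / ?L k"
    using eventually_gt_at_top[of 0]
  proof eventually_elim
    case (elim k)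
    define M where "M = M_num C k"
    have M: "M > 0" using M_num_pos by (simp add: M_def)
    have "(fact M :: real) \<le> real M ^ M"
      using fact_le_power[of M, where 'a = real] by simp
    then have "ln (fact M :: real) \<le> ln (real M ^ M)"
      using M by (intro ln_mono) auto
    also have "\<dots> = real M * ln (real M)" using M by (simp add: ln_realpow)
    also have "\<dots> \<le> real ((c * k + 1) ^ N) * ln (real ((c * k + 1) ^ N))"
    proof (intro mult_mono)
      show "real M \<le> real ((c * k + 1) ^ N)" using c(2) unfolding M_def by (rule of_nat_mono)
      then show "ln (real M) \<le> ln (real ((c * k + 1) ^ N))" using M by simp
    qed (use M in auto)
    also have "\<dots> = real ((c * k + 1) ^ N) * (real N * ln (real c * real k + 1))"
      using ln_realpow[of "real c * real k + 1" N] by (simp add: add_nonneg_pos add.commute)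
    also have "\<dots> \<le> real c ^ N * real (k + N) ^ N * (real N * ln (real c * real k + 1))"
      using linear_power_le[OF c(1), of k] unfolding N_def by (intro mult_right_mono) auto
    also have "\<dots> = ?b k * real (k + N) ^ Suc N"
      using N by (simp add: field_simps)
    finally have "ln (fact M) / real (L_num C k) \<le> ?b k * real (k + N) ^ Suc N / real (L_num C k)"
      by (rule divide_right_mono) simp
    then show ?case by (simp add: M_def)
  qed
  then have "(\<lambda>k. ln (fact (M_num C k)) / real (L_num C k)) \<longlonglongrightarrow> 0"
    by (rule tendsto_sandwich[OF always_eventually _ tendsto_const upper, rotated]) (simp add: fact_ge_1)
  then have "(\<lambda>k. exp (ln (fact (M_num C k)) / real (L_num C k))) \<longlonglongrightarrow> exp 0"
    by (rule tendsto_exp)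
  then show ?thesis by (simp add: powr_def)
qed

end

section \<open>Convergence of the normalized roots and the conclusion\<close>

context lattice_body_points
begin

lemma cheb_prod_powr_convergent: "\<exists>l. (\<lambda>k. cheb_prod k powr (1 / real (L_num C k))) \<longlonglongrightarrow> l"
proof (cases "\<exists>k. \<exists>\<alpha>\<in>lattice_pts C k. grlex_cheb C K k \<alpha> = 0")
  case True
  then obtain k \<alpha> where \<alpha>: "\<alpha> \<in> lattice_pts C k" "grlex_cheb C K k \<alpha> = 0" by blast
  \<comment> \<open>Submultiplicativity with \<open>\<beta> = 0\<close> carries one vanishing
    constant to all larger dilates.\<close>
  have "cheb_prod n = 0" if "n \<ge> k" for n
  proof -
    have "grlex_cheb C K n \<alpha> \<le> 0"
      using grlex_cheb_submultiplicative[OF \<alpha>(1) zero_mem_lattice_pts[of "n - k"]] \<alpha>(2) that by simp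
    then have "grlex_cheb C K n \<alpha> = 0" using grlex_cheb_nonneg[of n \<alpha>] by linarith
    then show ?thesis
      using \<alpha>(1) lattice_pts_mono[OF that] finite_lattice_pts unfolding cheb_prod_def by auto
  qed
  then have "\<forall>\<^sub>F n in sequentially. cheb_prod n powr (1 / real (L_num C n)) = 0"
    by (intro eventually_sequentiallyI[of k]) simp
  then show ?thesis by (intro exI[of _ 0] tendsto_eventually)
next
  case False
  then have pos: "grlex_cheb C K k \<alpha> > 0" if "\<alpha> \<in> lattice_pts C k" for k \<alpha>
    using that grlex_cheb_nonneg[of k \<alpha>] by fastforce
  \<comment> \<open>Subtracting from the trivial bound \<open>R ^ mdeg \<alpha>\<close> gives
    nonnegativity; submultiplicativity becomes superadditivity.\<close>
  define \<psi> where "\<psi> k \<alpha> = real (mdeg \<alpha>) * ln R - ln (grlex_cheb C K k \<alpha>)" for k \<alpha>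
  have "superadditive \<psi>"
    unfolding superadditive_def
  proof (intro conjI allI ballI)
    fix k \<alpha> assume \<alpha>: "\<alpha> \<in> lattice_pts C k"
    have "ln (grlex_cheb C K k \<alpha>) \<le> ln (R ^ mdeg \<alpha>)"
      using pos[OF \<alpha>] grlex_cheb_le[of k \<alpha>] by simp
    then show "0 \<le> \<psi> k \<alpha>" using R_pos by (simp add: \<psi>_def ln_realpow)
  next
    fix k l \<alpha> \<beta> assume \<alpha>: "\<alpha> \<in> lattice_pts C k" and \<beta>: "\<beta> \<in> lattice_pts C l"
    have "ln (grlex_cheb C K (k + l) (\<alpha> + \<beta>)) \<le> ln (grlex_cheb C K k \<alpha> * grlex_cheb C K l \<beta>)"
      using pos[OF lattice_pts_add[OF \<alpha> \<beta>]] grlex_cheb_submultiplicative[OF \<alpha> \<beta>] by simp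
    also have "\<dots> = ln (grlex_cheb C K k \<alpha>) + ln (grlex_cheb C K l \<beta>)"
      using pos[OF \<alpha>] pos[OF \<beta>] by (simp add: ln_mult)
    finally show "\<psi> k \<alpha> + \<psi> l \<beta> \<le> \<psi> (k + l) (\<alpha> + \<beta>)"
      by (simp add: \<psi>_def mdeg_add algebra_simps)
  qed
  define a where "a k = (\<Sum>\<alpha>\<in>lattice_pts C k. \<psi> k \<alpha>) / real (L_num C k)" for k
  have eq: "\<forall>\<^sub>F k in sequentially. exp (ln R - a k) = cheb_prod k powr (1 / real (L_num C k))"
    using eventually_gt_at_top[of 0]
  proof eventually_elim
    case (elim k)
    have cp: "cheb_prod k > 0" unfolding cheb_prod_def by (intro prod_pos pos)
    \<comment> \<open>The degrees sum to \<open>L_num C k\<close>, so after division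
      \<open>R\<close> contributes just \<open>ln R\<close>.\<close>
    have "(\<Sum>\<alpha>\<in>lattice_pts C k. \<psi> k \<alpha>) = real (L_num C k) * ln R - ln (cheb_prod k)"
      unfolding \<psi>_def cheb_prod_def L_num_def sum_subtractf
      using pos by (subst ln_prod) (auto simp: finite_lattice_pts sum_distrib_right dest: pos)
    then have "ln R - a k = ln (cheb_prod k) / real (L_num C k)"
      using L_num_pos[OF elim] by (simp add: a_def field_simps)
    then show ?case using cp by (simp add: powr_def)
  qed
  from \<open>superadditive \<psi>\<close> consider q where "a \<longlonglongrightarrow> q" | "filterlim a at_top sequentially"
    unfolding a_def using superadditive_average_cases by blast
  then have "\<exists>l. (\<lambda>k. exp (ln R - a k)) \<longlonglongrightarrow> l"
  proof cases
    case (1 q)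
    then show ?thesis
      by (intro exI[of _ "exp (ln R - q)"] tendsto_exp tendsto_diff tendsto_const)
  next
    \<comment> \<open>An infinite average makes the roots tend to 0.\<close>
    case 2
    have "filterlim (\<lambda>k. ln R - a k) at_bot sequentially"
      using filterlim_tendsto_add_at_top[OF tendsto_const 2, of "- ln R"]
      by (subst (asm) filterlim_uminus_at_top) simp
    then show ?thesis by (intro exI[of _ 0] filterlim_compose[OF exp_at_bot])
  qed
  then obtain l where "(\<lambda>k. exp (ln R - a k)) \<longlonglongrightarrow> l" by blast
  then have "(\<lambda>k. cheb_prod k powr (1 / real (L_num C k))) \<longlonglongrightarrow> l"
    by (rule Lim_transform_eventually[OF _ eq])
  then show ?thesis ..
qed

lemma V_max_powr_convergent: "\<exists>l. (\<lambda>k. V_max C K k powr (1 / real (L_num C k))) \<longlonglongrightarrow> l"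
proof -
  let ?e = "\<lambda>k. 1 / real (L_num C k)"
  obtain l where l: "(\<lambda>k. cheb_prod k powr ?e k) \<longlonglongrightarrow> l"
    using cheb_prod_powr_convergent by blast
  have upper: "(\<lambda>k. fact (M_num C k) powr ?e k * cheb_prod k powr ?e k) \<longlonglongrightarrow> 1 * l"
    by (intro tendsto_mult fact_M_num_powr_tendsto l)
  have "(\<lambda>k. V_max C K k powr ?e k) \<longlonglongrightarrow> l"
  proof (rule tendsto_sandwich[OF _ _ l])
    show "\<forall>\<^sub>F k in sequentially. cheb_prod k powr ?e k \<le> V_max C K k powr ?e k"
      using eventually_gt_at_top[of 0]
      by eventually_elim (intro powr_mono2 cheb_prod_nonneg cheb_prod_le cmod_VDM_le_V_max, auto)
    show "\<forall>\<^sub>F k in sequentially. V_max C K k powr ?e k \<le> fact (M_num C k) powr ?e k * cheb_prod k powr ?e k"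
      using eventually_gt_at_top[of 0]
    proof eventually_elim
      case (elim k)
      have "V_max C K k powr ?e k \<le> (fact (M_num C k) * cheb_prod k) powr ?e k"
        using elim by (intro powr_mono2 V_max_nonneg V_max_le cmod_VDM_le_cheb_prod) auto
      then show ?case by (simp add: powr_mult cheb_prod_nonneg)
    qed
    show "(\<lambda>k. fact (M_num C k) powr ?e k * cheb_prod k powr ?e k) \<longlonglongrightarrow> l"
      using upper by simp
  qed
  then show ?thesis by blast
qed

lemma Leja_powr_tendsto:
  assumes Leja: "C_Leja C K \<zeta>" and l: "(\<lambda>k. V_max C K k powr (1 / real (L_num C k))) \<longlonglongrightarrow> l"
  shows "(\<lambda>k. cmod (VDM C (M_num C k) \<zeta>) powr (1 / real (L_num C k))) \<longlonglongrightarrow> l"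
proof -
  let ?e = "\<lambda>k. 1 / real (L_num C k)"
  let ?\<Lambda> = "\<lambda>k. cmod (VDM C (M_num C k) \<zeta>)"
  have lower: "(\<lambda>k. V_max C K k powr ?e k / fact (M_num C k) powr ?e k) \<longlonglongrightarrow> l / 1"
    by (intro tendsto_divide fact_M_num_powr_tendsto l) simp
  show ?thesis
  proof (rule tendsto_sandwich[OF _ _ _ l])
    show "(\<lambda>k. V_max C K k powr ?e k / fact (M_num C k) powr ?e k) \<longlonglongrightarrow> l"
      using lower by simp
    show "\<forall>\<^sub>F k in sequentially. ?\<Lambda> k powr ?e k \<le> V_max C K k powr ?e k"
      using eventually_gt_at_top[of 0]
      by eventually_elim (intro powr_mono2 cmod_VDM_le_V_max, use Leja in \<open>auto simp: C_Leja_def\<close>)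
    show "\<forall>\<^sub>F k in sequentially. V_max C K k powr ?e k / fact (M_num C k) powr ?e k \<le> ?\<Lambda> k powr ?e k"
      using eventually_gt_at_top[of 0]
    proof eventually_elim
      case (elim k)
      have "V_max C K k powr ?e k \<le> (fact (M_num C k) * ?\<Lambda> k) powr ?e k"
        using elim by (intro powr_mono2 V_max_nonneg V_max_le_fact_mult_Leja[OF Leja]) auto
      also have "\<dots> = ?\<Lambda> k powr ?e k * fact (M_num C k) powr ?e k"
        by (simp add: powr_mult mult.commute)
      finally show ?case by (simp add: divide_le_eq)
    qed
  qed
qed

end

theorem theorem5p1:
  fixes C :: "(real ^ 'n::{finite,linorder}) set"
    and K :: "(complex ^ 'n::{finite,linorder}) set"
    and \<zeta> :: "nat \<Rightarrow> complex ^ 'n::{finite,linorder}"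
    and \<Lambda> :: "nat \<Rightarrow> real"
  assumes "compact C" and "convex C"
    and "C \<subseteq> nonneg_orthant" and "std_simplex_Rn \<subseteq> C"
    and "dagger_condition C"
    and "compact K"
    and "C_Leja C K \<zeta>"
    and "\<And>s. \<Lambda> s = cmod (VDM C s \<zeta>)"
  shows "(\<lambda>k. ereal (\<Lambda> (M_num C k) powr (1 / real (L_num C k))))
           \<longlonglongrightarrow> transfinite_diameter C K"
proof -
  obtain B where B: "\<And>z. z \<in> K \<Longrightarrow> norm z \<le> B"
    using compact_imp_bounded[OF \<open>compact K\<close>] by (auto simp: bounded_iff)
  \<comment> \<open>The maximum with 1 makes the bound positive, as the locale requires.\<close>
  have "cmod (vec_nth z i) \<le> max B 1" if "z \<in> K" for z i
    using order_trans[OF Finite_Cartesian_Product.norm_nth_le B[OF that], of i] by simp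
  moreover have "K \<noteq> {}" using assms(7) by (auto simp: C_Leja_def)
  ultimately interpret lattice_body_points C K "max B 1"
    using assms by unfold_locales auto
  obtain l where l: "(\<lambda>k. V_max C K k powr (1 / real (L_num C k))) \<longlonglongrightarrow> l"
    using V_max_powr_convergent by blast
  \<comment> \<open>The \<open>limsup\<close> in the definition is an actual limit, so the Leja
    roots converge to the same value.\<close>
  then have "transfinite_diameter C K = ereal l"
    unfolding transfinite_diameter_def by (intro lim_imp_Limsup) auto
  with Leja_powr_tendsto[OF assms(7) l] show ?thesis by (simp add: assms(8))
qed

end
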